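(* Let $g:[0,1]\to[0,\infty)$ be piecewise $C^2$ on $[0,1]$ and suppose that for some $\epsilon>0$ we have $g(x)\ge\epsilon$ on $[1-\epsilon,1]$. For $\beta\in\mathbb{R}$ let $T_\beta$ be the nonnegative random variable with $$\mathbb{E}\,e^{\theta T_\beta}=\exp\left(\int_0^1(e^{\theta x}-1)\,e^{\beta x}g(x)\,dx\right),\qquad \theta\in\mathbb{R},$$ let $E_\beta=\mathbb{E}\,T_\beta$, $\sigma_\beta=\sqrt{\operatorname{Var}T_\beta}$, let $$Y=Y_\beta:=\frac{T_\beta-E_\beta}{\sigma_\beta}$$ be the standardized version of $T_\beta$, and let $f_Y$ be the defective density function of $Y$. If $\beta\to\infty$, then $E_\beta\to\infty$ and $$f_Y(y)=\frac1{\sqrt{2\pi}}e^{-y^2/2}+O\left(\frac1{\sqrt{E_\beta}}\right)$$ uniformly in $y\in\mathbb{R}$. Further, for $y=0$ we have the stronger statement $$f_Y(0)=\frac1{\sqrt{2\pi}}+O\left(\frac1{E_\beta}\right).$$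
   Context: A function $g$ is piecewise $C^k$ on $[0,1]$ (integer $k\ge1$) if $[0,1]$ can be partitioned into finitely many subintervals on whose interiors $g$ is $C^k$, and $g$ and its first $k$ derivatives all possess finite one-sided limits at all the endpoints of the subintervals (so $g$ is bounded). $T_\beta$ is the sum of all arrivals in a Poisson process on $(0,1]$ with intensity $e^{\beta x}g(x)\,dx$. With $\lambda_\beta=\int_0^1e^{\beta x}g(x)\,dx<\infty$, $T_\beta$ has an atom at $0$ of mass $e^{-\lambda_\beta}$, so $Y_\beta$ has an atom at $-E_\beta/\sigma_\beta$ of the same mass; the rest of the distribution is absolutely continuous. The defective density (total mass $1-e^{-\lambda_\beta}$) of $T_\beta$ is $f_\beta=\sum_{k\ge1}e^{-\lambda_\beta}\frac{\lambda_\beta^k}{k!}q_\beta^{*k}$, where $q_\beta(x)=e^{\beta x}g(x)/\lambda_\beta$ on $[0,1]$ (and $0$ elsewhere) and $q_\beta^{*k}$ is the $k$-fold convolution; and the defective density of $Y$ is $f_Y(y)=\sigma_\beta f_\beta(\sigma_\beta y+E_\beta)$. The implied constants may depend on $g$ but not on $\beta$ (for $\beta$ large) or $y$. *)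

theory Defs
  imports "HOL-Probability.Probability"
begin

definition Ck_on :: "nat \<Rightarrow> (real \<Rightarrow> real) \<Rightarrow> real set \<Rightarrow> bool"
  where "Ck_on k g S \<longleftrightarrow>
    (\<forall>j<k. (deriv ^^ j) g differentiable_on S) \<and> (\<forall>j\<le>k. continuous_on S ((deriv ^^ j) g))"

text \<open>
  The partition is given by its endpoints \<open>0 = t\<^sub>0 < t\<^sub>1 < \<dots> < t\<^sub>n = 1\<close>. Nothing is required of
  the values of \<open>g\<close> at the points \<open>t\<^sub>i\<close> themselves, so it does not matter which
  subinterval contains a given endpoint, or whether one-point subintervals are used. All conditions
  are on open subintervals of the unit interval, so the values of \<open>g\<close> outside it play no role.
\<close>

definition piecewise_Ck_unit :: "nat \<Rightarrow> (real \<Rightarrow> real) \<Rightarrow> bool"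
  where "piecewise_Ck_unit k g \<longleftrightarrow>
    (\<exists>(n::nat) t :: nat \<Rightarrow> real. n \<ge> 1 \<and> t 0 = 0 \<and> t n = 1 \<and>
      (\<forall>i<n. t i < t (Suc i) \<and> Ck_on k g {t i<..<t (Suc i)} \<and>
        (\<forall>j\<le>k. (\<exists>l. ((deriv ^^ j) g \<longlongrightarrow> l) (at_right (t i))) \<and>
                (\<exists>l. ((deriv ^^ j) g \<longlongrightarrow> l) (at_left (t (Suc i)))))))"

definition total_intensity :: "(real \<Rightarrow> real) \<Rightarrow> real \<Rightarrow> real"
  where "total_intensity g \<beta> = (LBINT x:{0..1}. exp (\<beta> * x) * g x)"

definition jump_density :: "(real \<Rightarrow> real) \<Rightarrow> real \<Rightarrow> real \<Rightarrow> real"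
  where "jump_density g \<beta> x =
    (if x \<in> {0..1} then exp (\<beta> * x) * g x / total_intensity g \<beta> else 0)"

definition fun_convolution :: "(real \<Rightarrow> real) \<Rightarrow> (real \<Rightarrow> real) \<Rightarrow> real \<Rightarrow> real"
  where "fun_convolution f h x = (LBINT y. f (x - y) * h y)"

text \<open>The \<open>k\<close>-fold convolution of \<open>q\<close> with itself; only meaningful for \<open>k \<ge> 1\<close>.\<close>

definition convolution_power :: "(real \<Rightarrow> real) \<Rightarrow> nat \<Rightarrow> real \<Rightarrow> real"
  where "convolution_power q k = ((fun_convolution q) ^^ (k - 1)) q"

text \<open>
  The sum of the arrivals of a Poisson process on the half-open unit interval with intensity
  \<open>exp (\<beta> * x) * g x\<close> is compound Poisson: given that there are \<open>k \<ge> 1\<close> arrivals, which happens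
  with probability \<open>exp (- \<lambda>) * \<lambda> ^ k / fact k\<close>, where \<open>\<lambda> = total_intensity g \<beta>\<close>, it has
  density \<open>convolution_power (jump_density g \<beta>) k\<close>. The case \<open>k = 0\<close> gives the atom at \<open>0\<close>
  and is left out, so the total mass is \<open>1 - exp (- \<lambda>)\<close>. The series fixes the density
  at every point, not just almost everywhere.
\<close>

definition defective_density :: "(real \<Rightarrow> real) \<Rightarrow> real \<Rightarrow> real \<Rightarrow> real"
  where "defective_density g \<beta> x =
    (\<Sum>k. exp (- total_intensity g \<beta>) * total_intensity g \<beta> ^ Suc k / fact (Suc k) *
          convolution_power (jump_density g \<beta>) (Suc k) x)"

text \<open>
  The defective density of the standardization \<open>(T - E) / \<sigma>\<close> of a random variable \<open>T\<close> on \<open>M\<close>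
  that has \<open>defective_density g \<beta>\<close> as its defective density, with \<open>E\<close> and \<open>\<sigma>\<close> the mean and
  standard deviation of \<open>T\<close>.
\<close>

definition standardized_defective_density ::
    "(real \<Rightarrow> real) \<Rightarrow> real \<Rightarrow> 'a measure \<Rightarrow> ('a \<Rightarrow> real) \<Rightarrow> real \<Rightarrow> real"
  where "standardized_defective_density g \<beta> M T y =
    (let E = prob_space.expectation M T; \<sigma> = sqrt (prob_space.variance M T)
     in \<sigma> * defective_density g \<beta> (\<sigma> * y + E))"

end

theory Submission
  imports Defs
begin

text \<open>
  The proof is the Fourier-analytic proof of a local limit theorem. Let \<open>p x = exp (\<beta> * x) * g x\<close> on the
  unit interval, with moments \<open>m k\<close>, and let \<open>\<psi>\<close> be its Fourier transform. The Poisson mixture of the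
  \<open>k\<close>-fold convolutions of \<open>p\<close>, with the two terms \<open>k = 0\<close> and \<open>k = 1\<close> left out, has the integrable
  transform \<open>exp (- m 0) * (exp \<psi> - 1 - \<psi>)\<close>, and is therefore given at every point by the inversion
  integral (\<open>compound_density_inversion\<close>). The term \<open>k = 1\<close> is \<open>exp (- m 0) * p\<close>, which is at most
  \<open>exp (- m 0) * sup p\<close> everywhere, even at the points where \<open>g\<close> jumps. The term \<open>k = 0\<close> is the atom.

  Because all arrivals lie in the unit interval, \<open>m k \<le> m 2\<close> for \<open>k \<ge> 2\<close>. So, with \<open>E = m 1\<close> and
  \<open>V = m 2\<close> the mean and the variance, \<open>\<psi> t - m 0 = \<i> * t * E - V * t^2 / 2\<close> up to an error of at
  most \<open>V * \<bar>t\<bar>^3 / 6\<close>. On \<open>\<bar>t\<bar> \<le> 1\<close> this is at most a third of the quadratic term, so that the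
  transform stays within \<open>V * \<bar>t\<bar>^3 * exp (- V * t^2 / 3)\<close> of the transform of the normal density,
  apart from an exponentially small term for the two removed summands. The integral of this bound,
  multiplied by the standard deviation, is \<open>O(1 / sqrt V)\<close>. At \<open>y = 0\<close> the oscillating factor disappears,
  the leading cubic term of the error is odd and integrates to \<open>0\<close>, and the terms of order \<open>t^4\<close> and \<open>t^6\<close> leave \<open>O(1 / V)\<close>. These are the bounds of \<open>local_limit_bounds\<close>.

  On \<open>\<bar>t\<bar> > 1\<close> only a crude estimate is needed. The lower bound on \<open>g\<close> near \<open>1\<close> gives a spectral gap
  \<open>\<bar>Re (\<psi> t)\<bar> \<le> m 0 - c * exp (\<beta> / 2)\<close> (\<open>spectral_gap\<close>). The transform is then at most
  \<open>exp (- c * exp (\<beta> / 2)) * \<bar>\<psi> t\<bar>^2\<close>, and \<open>\<bar>\<psi>\<bar>^2\<close> has an integral of order \<open>exp (2 * \<beta>)\<close> by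
  Plancherel's inequality (\<open>plancherel_inequality\<close>), so the double exponential wins against every power of \<open>exp \<beta>\<close>.

  Finally, \<open>E\<close> and \<open>V\<close> are comparable: the part of the mass below \<open>1 / 2\<close> is at most of order \<open>exp (\<beta> / 2)\<close>,
  and so is bounded by a multiple of \<open>V\<close>. That \<open>m 1\<close> and \<open>m 2\<close> are the mean and the variance of \<open>T\<close> is read off
  the moment generating function (\<open>moments_from_mgf\<close>).
\<close>

section \<open>Fourier transforms of integrable functions on the line\<close>

definition fourier :: "(real \<Rightarrow> real) \<Rightarrow> real \<Rightarrow> complex"
  where "fourier q t = (\<integral>x. iexp (t * x) * complex_of_real (q x) \<partial>lborel)"

lemma integrable_iexp_mult:
  fixes f :: "real \<Rightarrow> complex"
  assumes "integrable lborel f"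
  shows "integrable lborel (\<lambda>x. iexp (a * x) * f x)"
  by (rule Bochner_Integration.integrable_bound[OF assms])
     (use assms in \<open>auto simp: norm_mult\<close>)

lemma integrable_inverse_iexp_mult:
  fixes f :: "real \<Rightarrow> complex"
  assumes "integrable lborel f"
  shows "integrable lborel (\<lambda>t. iexp (- (t * x)) * f t)"
proof -
  have "- (t * x) = - x * t" for t by simp
  then show ?thesis
    using integrable_iexp_mult[OF assms, of "- x"] by (simp only:)
qed

lemma fourier_measurable [measurable]:
  assumes [measurable]: "q \<in> borel_measurable borel"
  shows "fourier q \<in> borel_measurable borel"
  unfolding fourier_def by measurable

lemma norm_fourier_le: "norm (fourier q t) \<le> (\<integral>x. \<bar>q x\<bar> \<partial>lborel)"
proof -
  have "norm (fourier q t) \<le> (\<integral>x. norm (iexp (t * x) * complex_of_real (q x)) \<partial>lborel)"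
    unfolding fourier_def by (rule integral_norm_bound)
  then show ?thesis by (simp add: norm_mult)
qed

lemma cnj_fourier: "cnj (fourier q t) = fourier (\<lambda>x. q (- x)) t"
proof -
  have "cnj (fourier q t) = (\<integral>x. iexp (t * (0 + (-1) * x)) * complex_of_real (q (0 + (- 1) * (- x))) \<partial>lborel)"
    unfolding fourier_def by (subst Bochner_Integration.integral_cnj[symmetric]) (simp add: exp_cnj)
  also have "\<dots> = fourier (\<lambda>x. q (- x)) t"
    unfolding fourier_def by (subst lborel_integral_real_affine[where c="-1" and t=0]) simp_all
  finally show ?thesis .
qed

lemma fourier_scale: "fourier (\<lambda>x. c * q x) t = complex_of_real c * fourier q t"
  unfolding fourier_def by (simp add: mult.left_commute[of _ "complex_of_real c"])

lemma fourier_reflect_translate: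
  assumes "integrable lborel q"
  shows "(\<integral>y. complex_of_real (q (x - y)) * iexp (- (t * y)) \<partial>lborel) = iexp (- (t * x)) * fourier q t"
proof -
  have "(\<integral>y. complex_of_real (q (x - y)) * iexp (- (t * y)) \<partial>lborel)
      = (\<integral>y. complex_of_real (q y) * iexp (- (t * (x - y))) \<partial>lborel)"
    by (subst lborel_integral_real_affine[where c="-1" and t=x]) simp_all
  also have "\<dots> = (\<integral>y. iexp (- (t * x)) * (iexp (t * y) * complex_of_real (q y)) \<partial>lborel)"
    by (intro Bochner_Integration.integral_cong refl) (simp add: exp_add[symmetric] algebra_simps exp_diff exp_minus divide_simps)
  also have "\<dots> = iexp (- (t * x)) * fourier q t"
    unfolding fourier_def by simp
  finally show ?thesis .
qed

lemma integrable_fourier_mult: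
  fixes \<Phi> :: "real \<Rightarrow> complex"
  assumes "q \<in> borel_measurable borel" and "integrable lborel \<Phi>"
  shows "integrable lborel (\<lambda>t. fourier q t * \<Phi> t)"
proof (rule Bochner_Integration.integrable_bound)
  show "integrable lborel (\<lambda>t. complex_of_real (\<integral>x. \<bar>q x\<bar> \<partial>lborel) * \<Phi> t)"
    using assms(2) by simp
  show "AE t in lborel. norm (fourier q t * \<Phi> t) \<le> norm (complex_of_real (\<integral>x. \<bar>q x\<bar> \<partial>lborel) * \<Phi> t)"
    by (intro AE_I2) (auto simp: norm_mult intro!: mult_right_mono order_trans[OF norm_fourier_le])
  show "(\<lambda>t. fourier q t * \<Phi> t) \<in> borel_measurable lborel"
    using assms by measurable
qed

text \<open>
  Fubini's theorem: convolving an inverse Fourier integral with \<open>q\<close> multiplies its integrand by the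
  transform of \<open>q\<close>. Smoothing, Plancherel's inequality and the inversion of all convolution powers
  are instances of this one identity, for different choices of \<open>\<Phi>\<close>.
\<close>

lemma convolution_inverse_fourier:
  fixes \<Phi> :: "real \<Rightarrow> complex"
  assumes q: "integrable lborel q" and \<Phi>: "integrable lborel \<Phi>"
  shows "(\<integral>y. complex_of_real (q (x - y)) * (\<integral>t. iexp (- (t * y)) * \<Phi> t \<partial>lborel) \<partial>lborel)
       = (\<integral>t. iexp (- (t * x)) * (fourier q t * \<Phi> t) \<partial>lborel)"
proof -
  have [measurable]: "q \<in> borel_measurable borel" "\<Phi> \<in> borel_measurable borel"
    using q \<Phi> by auto
  let ?f = "\<lambda>(y, t). complex_of_real (q (x - y)) * (iexp (- (t * y)) * \<Phi> t)"
  have qx: "integrable lborel (\<lambda>y. \<bar>q (x - y)\<bar>)"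
    using lborel_integrable_real_affine[OF q, of "-1" x] by simp
  have int: "integrable (lborel \<Otimes>\<^sub>M lborel) ?f"
  proof (rule lborel_pair.Fubini_integrable)
    show "?f \<in> borel_measurable (lborel \<Otimes>\<^sub>M lborel)"
      by measurable
    show "integrable lborel (\<lambda>y. \<integral>t. norm (?f (y, t)) \<partial>lborel)"
      using qx by (simp add: norm_mult)
    show "AE y in lborel. integrable lborel (\<lambda>t. ?f (y, t))"
      using integrable_iexp_mult[OF \<Phi>, of "- y" for y] by (simp add: mult.commute)
  qed
  have "(\<integral>y. complex_of_real (q (x - y)) * (\<integral>t. iexp (- (t * y)) * \<Phi> t \<partial>lborel) \<partial>lborel)
      = (\<integral>y. (\<integral>t. ?f (y, t) \<partial>lborel) \<partial>lborel)"
    by simp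
  also have "\<dots> = (\<integral>t. (\<integral>y. ?f (y, t) \<partial>lborel) \<partial>lborel)"
    using lborel_pair.Fubini_integral[OF int] by simp
  also have "\<dots> = (\<integral>t. (\<integral>y. complex_of_real (q (x - y)) * iexp (- (t * y)) \<partial>lborel) * \<Phi> t \<partial>lborel)"
    by (simp add: mult.assoc[symmetric])
  also have "\<dots> = (\<integral>t. iexp (- (t * x)) * (fourier q t * \<Phi> t) \<partial>lborel)"
    by (simp only: fourier_reflect_translate[OF q] mult.assoc)
  finally show ?thesis .
qed

lemma integrable_gaussian:
  fixes a :: real assumes "a > 0"
  shows "integrable lborel (\<lambda>t. \<bar>t\<bar> ^ k * exp (- (a\<^sup>2 * t\<^sup>2 / 2)))"
proof -
  have "integrable lborel (\<lambda>u::real. \<bar>u\<bar> ^ k * exp (- (u\<^sup>2 / 2)))"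
    using integrable_mult_right[OF integrable_std_normal_moment_abs[of k], of "sqrt (2 * pi)"]
    by (simp add: normal_density_def mult_ac)
  from integrable_mult_right[OF lborel_integrable_real_affine[OF this, of a 0], of "1 / a ^ k"]
  show ?thesis using assms
    by (simp add: power_mult_distrib abs_mult mult.assoc[symmetric])
qed

text \<open>
  The powers of \<open>a\<close> give the orders of magnitude of all error terms below: with \<open>a\<close> proportional to the
  standard deviation, each factor \<open>\<bar>t\<bar>\<close> in an integrand gains one factor \<open>1 / a\<close>.
\<close>

lemma integral_gaussian_moment:
  fixes a :: real assumes "a > 0"
  shows "(\<integral>t. \<bar>t\<bar> ^ k * exp (- (a\<^sup>2 * t\<^sup>2 / 2)) \<partial>lborel)
       = (\<integral>u. \<bar>u\<bar> ^ k * exp (- (u\<^sup>2 / 2)) \<partial>lborel) / a ^ Suc k"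
proof -
  have "(\<integral>u. \<bar>u\<bar> ^ k * exp (- (u\<^sup>2 / 2)) \<partial>lborel)
      = a * (\<integral>t. \<bar>a * t\<bar> ^ k * exp (- ((a * t)\<^sup>2 / 2)) \<partial>lborel)"
    using assms by (subst lborel_integral_real_affine[where c=a and t=0]) simp_all
  also have "\<dots> = a * (\<integral>t. a ^ k * (\<bar>t\<bar> ^ k * exp (- (a\<^sup>2 * t\<^sup>2 / 2))) \<partial>lborel)"
    using assms by (simp add: power_mult_distrib abs_mult mult.assoc)
  finally show ?thesis using assms by simp
qed

lemma fourier_gaussian:
  fixes a z :: real assumes "a > 0"
  shows "(\<integral>t. iexp (- (t * z)) * complex_of_real (exp (- (a\<^sup>2 * t\<^sup>2 / 2))) \<partial>lborel)
       = complex_of_real (2 * pi / a * std_normal_density (z / a))"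
proof -
  have "complex_of_real (exp (- ((z / a)\<^sup>2 / 2))) = char std_normal_distribution (- (z / a))"
    by (simp add: char_std_normal_distribution)
  also have "\<dots> = (\<integral>u. iexp (- (z / a) * u) * std_normal_density u \<partial>lborel)"
    unfolding char_def by (subst integral_density) (auto simp: normal_density_nonneg scaleR_conv_of_real mult.commute)
  also have "\<dots> = a * (\<integral>t. iexp (- (z / a) * (0 + a * t)) * std_normal_density (0 + a * t) \<partial>lborel)"
    using assms by (subst lborel_integral_real_affine[where c=a and t=0]) (simp_all add: scaleR_conv_of_real)
  also have "\<dots> = a * (\<integral>t. complex_of_real (1 / sqrt (2 * pi)) * (iexp (- (t * z)) * exp (- (a\<^sup>2 * t\<^sup>2 / 2))) \<partial>lborel)"
  proof -
    have "iexp (- (z / a) * (0 + a * t)) * std_normal_density (0 + a * t)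
        = complex_of_real (1 / sqrt (2 * pi)) * (iexp (- (t * z)) * exp (- (a\<^sup>2 * t\<^sup>2 / 2)))" for t
    proof -
      have 1: "- (z / a) * (0 + a * t) = - (t * z)"
        using assms by simp
      have 2: "std_normal_density (0 + a * t) = 1 / sqrt (2 * pi) * exp (- (a\<^sup>2 * t\<^sup>2 / 2))"
        by (simp add: normal_density_def power_mult_distrib)
      show ?thesis
        unfolding 1 2 of_real_mult by (rule mult.left_commute)
    qed
    then show ?thesis by (simp only:)
  qed
  also have "\<dots> = a * (complex_of_real (1 / sqrt (2 * pi)) * (\<integral>t. iexp (- (t * z)) * exp (- (a\<^sup>2 * t\<^sup>2 / 2)) \<partial>lborel))"
    by (subst integral_mult_right_zero) simp
  finally have *: "complex_of_real (exp (- ((z / a)\<^sup>2 / 2))) =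
     complex_of_real (a / sqrt (2 * pi)) * (\<integral>t. iexp (- (t * z)) * exp (- (a\<^sup>2 * t\<^sup>2 / 2)) \<partial>lborel)"
    by simp
  have sq: "2 * pi / sqrt (2 * pi) = sqrt (2 * pi)"
    by (simp add: real_div_sqrt)
  have "2 * pi / a * std_normal_density (z / a) = 2 * pi / sqrt (2 * pi) / a * exp (- ((z / a)\<^sup>2 / 2))"
    by (simp add: normal_density_def)
  then have "complex_of_real (2 * pi / a * std_normal_density (z / a))
      = complex_of_real (sqrt (2 * pi) / a) * complex_of_real (exp (- ((z / a)\<^sup>2 / 2)))"
    unfolding sq by (simp only: of_real_mult[symmetric])
  also have "\<dots> = complex_of_real (sqrt (2 * pi) / a * (a / sqrt (2 * pi)))
      * (\<integral>t. iexp (- (t * z)) * exp (- (a\<^sup>2 * t\<^sup>2 / 2)) \<partial>lborel)"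
    unfolding * of_real_mult by (rule mult.assoc[symmetric])
  also have "sqrt (2 * pi) / a * (a / sqrt (2 * pi)) = 1"
    using assms by simp
  finally show ?thesis by simp
qed

section \<open>Gaussian smoothing, Plancherel's inequality and inversion of convolution powers\<close>

lemma integrable_gaussian_complex:
  assumes "a > 0"
  shows "integrable lborel (\<lambda>t. complex_of_real (exp (- (a\<^sup>2 * t\<^sup>2 / 2))))"
  using integrable_gaussian[OF assms, of 0] by simp

text \<open>
  Up to the factor \<open>2 * pi\<close>, this is \<open>q\<close> convolved with the centred normal density of standard deviation
  \<open>a\<close>; the Gaussian factor makes the inversion integral converge even where the transform of \<open>q\<close> is not integrable.
\<close>

definition smoothed_inverse :: "(real \<Rightarrow> real) \<Rightarrow> real \<Rightarrow> real \<Rightarrow> complex"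
  where "smoothed_inverse q a u =
    (\<integral>t. iexp (- (t * u)) * (fourier q t * complex_of_real (exp (- (a\<^sup>2 * t\<^sup>2 / 2)))) \<partial>lborel)"

lemma smoothed_inverse_eq:
  assumes q: "integrable lborel q" and a: "a > 0"
  shows "smoothed_inverse q a u = complex_of_real (2 * pi * (\<integral>w. q (u - a * w) * std_normal_density w \<partial>lborel))"
proof -
  have "smoothed_inverse q a u
      = (\<integral>v. complex_of_real (q (u - v)) * complex_of_real (2 * pi / a * std_normal_density (v / a)) \<partial>lborel)"
    unfolding smoothed_inverse_def
    by (simp only: convolution_inverse_fourier[OF q integrable_gaussian_complex[OF a], symmetric] fourier_gaussian[OF a])
  also have "\<dots> = complex_of_real (\<integral>v. q (u - v) * (2 * pi / a * std_normal_density (v / a)) \<partial>lborel)"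
    by (simp only: of_real_mult[symmetric] integral_complex_of_real)
  also have "(\<integral>v. q (u - v) * (2 * pi / a * std_normal_density (v / a)) \<partial>lborel)
      = a * (\<integral>w. q (u - (0 + a * w)) * (2 * pi / a * std_normal_density ((0 + a * w) / a)) \<partial>lborel)"
    using a by (subst lborel_integral_real_affine[where c=a and t=0]) simp_all
  also have "\<dots> = a * (\<integral>w. 2 * pi / a * (q (u - a * w) * std_normal_density w) \<partial>lborel)"
  proof -
    have "(0 + a * w) / a = w" for w
      using a by simp
    then show ?thesis
      by (simp only: add_0 mult.left_commute)
  qed
  also have "\<dots> = 2 * pi * (\<integral>w. q (u - a * w) * std_normal_density w \<partial>lborel)"
    using a by simp
  finally show ?thesis .
qed

lemma smoothed_inverse_bound:
  assumes q: "integrable lborel q" and B: "\<And>x. \<bar>q x\<bar> \<le> B" and a: "a > 0"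
  shows "norm (smoothed_inverse q a u) \<le> 2 * pi * B"
proof -
  have [measurable]: "q \<in> borel_measurable borel" using q by auto
  have B0: "0 \<le> B" using B[of 0] by simp
  have "\<bar>\<integral>w. q (u - a * w) * std_normal_density w \<partial>lborel\<bar>
      \<le> (\<integral>w. \<bar>q (u - a * w) * std_normal_density w\<bar> \<partial>lborel)"
    using integral_norm_bound[of lborel "\<lambda>w. q (u - a * w) * std_normal_density w"] by simp
  also have "\<dots> \<le> (\<integral>w. B * std_normal_density w \<partial>lborel)"
  proof (rule integral_mono')
    show "integrable lborel (\<lambda>w. B * std_normal_density w)" by simp
  qed (use B B0 in \<open>auto simp: abs_mult normal_density_nonneg intro!: mult_right_mono\<close>)
  also have "\<dots> = B" by simp
  finally show ?thesis
    unfolding smoothed_inverse_eq[OF q a] norm_of_real abs_mult by simp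
qed

lemma smoothed_inverse_tendsto:
  assumes q: "integrable lborel q" and B: "\<And>x. \<bar>q x\<bar> \<le> B" and cont: "isCont q u"
  shows "(\<lambda>n. smoothed_inverse q (1 / real (Suc n)) u) \<longlonglongrightarrow> complex_of_real (2 * pi * q u)"
proof -
  have [measurable]: "q \<in> borel_measurable borel" using q by auto
  have "(\<lambda>n. \<integral>w. q (u - 1 / real (Suc n) * w) * std_normal_density w \<partial>lborel)
      \<longlonglongrightarrow> (\<integral>w. q u * std_normal_density w \<partial>lborel)"
  proof (rule integral_dominated_convergence[where w="\<lambda>w. B * std_normal_density w"])
    show "AE w in lborel. (\<lambda>n. q (u - 1 / real (Suc n) * w) * std_normal_density w)
        \<longlonglongrightarrow> q u * std_normal_density w"
    proof (intro AE_I2 tendsto_intros)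
      fix w :: real
      have "(\<lambda>n. u - 1 / real (Suc n) * w) \<longlonglongrightarrow> u - 0 * w"
        by (intro tendsto_intros LIMSEQ_Suc[OF lim_1_over_n])
      then show "(\<lambda>n. q (u - 1 / real (Suc n) * w)) \<longlonglongrightarrow> q u"
        using isCont_tendsto_compose[OF cont] by simp
    qed
    show "AE w in lborel. norm (q (u - 1 / real (Suc n) * w) * std_normal_density w)
        \<le> B * std_normal_density w" for n
      using B by (auto simp: abs_mult normal_density_nonneg intro!: AE_I2 mult_right_mono)
  qed simp_all
  then have "(\<lambda>n. complex_of_real (2 * pi * (\<integral>w. q (u - 1 / real (Suc n) * w) * std_normal_density w \<partial>lborel)))
      \<longlonglongrightarrow> complex_of_real (2 * pi * (q u * 1))"
    by (intro tendsto_intros) simp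
  moreover have "smoothed_inverse q (1 / real (Suc n)) u
      = complex_of_real (2 * pi * (\<integral>w. q (u - 1 / real (Suc n) * w) * std_normal_density w \<partial>lborel))" for n
    by (rule smoothed_inverse_eq[OF q]) simp
  ultimately show ?thesis by (simp only: mult_1_right)
qed

lemma exp_gaussian_tendsto_1:
  "(\<lambda>n. exp (- ((1 / real (Suc n))\<^sup>2 * t\<^sup>2 / 2))) \<longlonglongrightarrow> (1::real)"
proof -
  have "(\<lambda>n. exp (- ((1 / real (Suc n))\<^sup>2 * t\<^sup>2 / 2))) \<longlonglongrightarrow> exp (- (0\<^sup>2 * t\<^sup>2 / 2))"
    by (intro tendsto_intros LIMSEQ_Suc[OF lim_1_over_n]) simp
  then show ?thesis by simp
qed

text \<open>
  The squared modulus of the transform of \<open>q\<close> is the product of the transforms of \<open>q\<close> and of its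
  reflection. Hence its Gaussian-weighted integral is the integral of \<open>q\<close> against its own smoothing,
  and the smoothing inherits the bound of \<open>q\<close>.
\<close>

lemma plancherel_smoothed:
  assumes q: "integrable lborel q" and B: "\<And>x. \<bar>q x\<bar> \<le> B" and a: "a > 0"
  shows "integrable lborel (\<lambda>t. (norm (fourier q t))\<^sup>2 * exp (- (a\<^sup>2 * t\<^sup>2 / 2)))"
    and "(\<integral>t. (norm (fourier q t))\<^sup>2 * exp (- (a\<^sup>2 * t\<^sup>2 / 2)) \<partial>lborel) \<le> 2 * pi * B * (\<integral>x. \<bar>q x\<bar> \<partial>lborel)"
proof -
  have qm [measurable]: "q \<in> borel_measurable borel" using q by auto
  define \<Phi> where "\<Phi> t = fourier q t * complex_of_real (exp (- (a\<^sup>2 * t\<^sup>2 / 2)))" for t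
  have \<Phi>: "integrable lborel \<Phi>"
    unfolding \<Phi>_def by (intro integrable_fourier_mult qm integrable_gaussian_complex a)
  have q': "integrable lborel (\<lambda>x. q (- x))"
    using lborel_integrable_real_affine[OF q, of "-1" 0] by simp
  have eq: "fourier (\<lambda>x. q (- x)) t * \<Phi> t = complex_of_real ((norm (fourier q t))\<^sup>2 * exp (- (a\<^sup>2 * t\<^sup>2 / 2)))" for t
    unfolding \<Phi>_def cnj_fourier[symmetric] of_real_mult complex_norm_square by (simp add: mult_ac)
  have "integrable lborel (\<lambda>t. fourier (\<lambda>x. q (- x)) t * \<Phi> t)"
    by (intro integrable_fourier_mult \<Phi>) simp
  then show "integrable lborel (\<lambda>t. (norm (fourier q t))\<^sup>2 * exp (- (a\<^sup>2 * t\<^sup>2 / 2)))"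
    unfolding eq complex_of_real_integrable_eq .
  have "complex_of_real (\<integral>t. (norm (fourier q t))\<^sup>2 * exp (- (a\<^sup>2 * t\<^sup>2 / 2)) \<partial>lborel)
      = (\<integral>t. iexp (- (t * 0)) * (fourier (\<lambda>x. q (- x)) t * \<Phi> t) \<partial>lborel)"
    unfolding eq
    by (simp only: mult_zero_right minus_zero of_real_0 exp_zero mult_1_left integral_complex_of_real)
  also have "\<dots> = (\<integral>y. complex_of_real (q (- (0 - y))) * (\<integral>t. iexp (- (t * y)) * \<Phi> t \<partial>lborel) \<partial>lborel)"
    by (rule convolution_inverse_fourier[OF q' \<Phi>, symmetric])
  also have "\<dots> = (\<integral>y. complex_of_real (q y) * smoothed_inverse q a y \<partial>lborel)"
    by (simp add: \<Phi>_def smoothed_inverse_def)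
  finally have "norm (complex_of_real (\<integral>t. (norm (fourier q t))\<^sup>2 * exp (- (a\<^sup>2 * t\<^sup>2 / 2)) \<partial>lborel))
      \<le> (\<integral>y. norm (complex_of_real (q y) * smoothed_inverse q a y) \<partial>lborel)"
    by (simp only: integral_norm_bound)
  also have "\<dots> \<le> (\<integral>y. \<bar>q y\<bar> * (2 * pi * B) \<partial>lborel)"
    using q B[of 0] by (intro integral_mono')
      (auto simp: norm_mult intro!: mult_left_mono smoothed_inverse_bound[OF q B a]
        order_trans[OF _ smoothed_inverse_bound[OF q B a]])
  finally show "(\<integral>t. (norm (fourier q t))\<^sup>2 * exp (- (a\<^sup>2 * t\<^sup>2 / 2)) \<partial>lborel) \<le> 2 * pi * B * (\<integral>x. \<bar>q x\<bar> \<partial>lborel)"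
    by (simp add: mult_ac)
qed

text \<open>
  Fatou's lemma removes the Gaussian weight. Only the bound on \<open>q\<close> enters, so jumps of \<open>q\<close> do no harm
  although its transform then fails to be integrable.
\<close>

lemma plancherel_inequality:
  assumes q: "integrable lborel q" and B: "\<And>x. \<bar>q x\<bar> \<le> B"
  shows "integrable lborel (\<lambda>t. (norm (fourier q t))\<^sup>2)"
    and "(\<integral>t. (norm (fourier q t))\<^sup>2 \<partial>lborel) \<le> 2 * pi * B * (\<integral>x. \<bar>q x\<bar> \<partial>lborel)"
proof -
  have [measurable]: "q \<in> borel_measurable borel" using q by auto
  let ?K = "2 * pi * B * (\<integral>x. \<bar>q x\<bar> \<partial>lborel)"
  let ?f = "\<lambda>n t. (norm (fourier q t))\<^sup>2 * exp (- ((1 / real (Suc n))\<^sup>2 * t\<^sup>2 / 2))"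
  have B0: "0 \<le> B" using B[of 0] by simp
  have K: "0 \<le> ?K" using B0 by simp
  have lim: "(\<lambda>n. ?f n t) \<longlonglongrightarrow> (norm (fourier q t))\<^sup>2" for t
    using tendsto_mult[OF tendsto_const exp_gaussian_tendsto_1] by simp
  have "(\<integral>\<^sup>+t. ennreal ((norm (fourier q t))\<^sup>2) \<partial>lborel) = (\<integral>\<^sup>+t. liminf (\<lambda>n. ennreal (?f n t)) \<partial>lborel)"
    by (intro nn_integral_cong lim_imp_Liminf[symmetric] tendsto_ennrealI lim) simp
  also have "\<dots> \<le> liminf (\<lambda>n. \<integral>\<^sup>+t. ennreal (?f n t) \<partial>lborel)"
    by (rule nn_integral_liminf) measurable
  also have "\<dots> \<le> liminf (\<lambda>n::nat. ennreal ?K)"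
  proof (intro Liminf_mono always_eventually allI)
    fix n
    have "(\<integral>\<^sup>+t. ennreal (?f n t) \<partial>lborel) = ennreal (\<integral>t. ?f n t \<partial>lborel)"
      using plancherel_smoothed(1)[OF q B, of "1 / real (Suc n)"] by (intro nn_integral_eq_integral) auto
    also have "\<dots> \<le> ennreal ?K"
      using plancherel_smoothed(2)[OF q B, of "1 / real (Suc n)"] by (intro ennreal_leI) auto
    finally show "(\<integral>\<^sup>+t. ennreal (?f n t) \<partial>lborel) \<le> ennreal ?K" .
  qed
  also have "\<dots> = ennreal ?K" by (simp add: Liminf_const)
  finally have le: "(\<integral>\<^sup>+t. ennreal ((norm (fourier q t))\<^sup>2) \<partial>lborel) \<le> ennreal ?K" .
  show int: "integrable lborel (\<lambda>t. (norm (fourier q t))\<^sup>2)"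
    by (rule integrableI_bounded) (use le in \<open>auto simp: le_less_trans[OF _ ennreal_less_top]\<close>)
  show "(\<integral>t. (norm (fourier q t))\<^sup>2 \<partial>lborel) \<le> ?K"
    using le K by (subst (asm) nn_integral_eq_integral[OF int]) (auto simp: ennreal_le_iff)
qed

lemma fourier_power_integrable:
  assumes q: "integrable lborel q" and B: "\<And>x. \<bar>q x\<bar> \<le> B"
  shows "integrable lborel (\<lambda>t. fourier q t ^ Suc (Suc k))"
proof (induction k)
  case 0
  have [measurable]: "q \<in> borel_measurable borel" using q by auto
  show ?case
    by (rule Bochner_Integration.integrable_bound[OF plancherel_inequality(1)[OF q B]])
       (auto simp: norm_mult power2_eq_square)
next
  case (Suc k)
  have [measurable]: "q \<in> borel_measurable borel" using q by auto
  show ?case using integrable_fourier_mult[OF _ Suc, of q] by simp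
qed

text \<open>
  Inversion holds at every point, not just almost everywhere, because from the second power on the
  transform is integrable. For the square, \<open>q\<close> is convolved with its smoothings, which converge to \<open>q\<close> at
  every continuity point and are uniformly bounded; dominated convergence on both sides of
  \<open>convolution_inverse_fourier\<close> gives the claim. Each further power is one more use of that identity.
\<close>

lemma convolution_power_inversion:
  assumes q: "integrable lborel q" and B: "\<And>x. \<bar>q x\<bar> \<le> B" and cont: "AE u in lborel. isCont q u"
  shows "complex_of_real (2 * pi * convolution_power q (Suc (Suc k)) x)
       = (\<integral>t. iexp (- (t * x)) * fourier q t ^ Suc (Suc k) \<partial>lborel)"
proof (induction k arbitrary: x)
  case 0
  have qm [measurable]: "q \<in> borel_measurable borel" using q by auto
  have qx: "integrable lborel (\<lambda>y. q (x - y))"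
    using lborel_integrable_real_affine[OF q, of "-1" x] by simp
  let ?a = "\<lambda>n. 1 / real (Suc n)"
  have "(\<lambda>n. \<integral>y. complex_of_real (q (x - y)) * smoothed_inverse q (?a n) y \<partial>lborel)
      \<longlonglongrightarrow> (\<integral>y. complex_of_real (q (x - y)) * complex_of_real (2 * pi * q y) \<partial>lborel)"
  proof (rule integral_dominated_convergence[where w="\<lambda>y. \<bar>q (x - y)\<bar> * (2 * pi * B)"])
    show "AE y in lborel. (\<lambda>n. complex_of_real (q (x - y)) * smoothed_inverse q (?a n) y)
        \<longlonglongrightarrow> complex_of_real (q (x - y)) * complex_of_real (2 * pi * q y)"
      using cont by eventually_elim (intro tendsto_intros smoothed_inverse_tendsto[OF q B])
    show "AE y in lborel. norm (complex_of_real (q (x - y)) * smoothed_inverse q (?a n) y) \<le> \<bar>q (x - y)\<bar> * (2 * pi * B)" for n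
      by (intro AE_I2) (auto simp: norm_mult intro!: mult_left_mono smoothed_inverse_bound[OF q B])
    show "(\<lambda>y. complex_of_real (q (x - y)) * smoothed_inverse q (?a n) y) \<in> borel_measurable lborel" for n
      unfolding smoothed_inverse_def by measurable
  qed (use qx in auto)
  moreover have "(\<integral>y. complex_of_real (q (x - y)) * smoothed_inverse q (?a n) y \<partial>lborel)
      = (\<integral>t. iexp (- (t * x)) * (fourier q t * (fourier q t * complex_of_real (exp (- ((?a n)\<^sup>2 * t\<^sup>2 / 2))))) \<partial>lborel)" for n
    unfolding smoothed_inverse_def
    by (intro convolution_inverse_fourier q integrable_fourier_mult qm integrable_gaussian_complex) simp
  moreover have "(\<lambda>n. \<integral>t. iexp (- (t * x)) * (fourier q t * (fourier q t * complex_of_real (exp (- ((?a n)\<^sup>2 * t\<^sup>2 / 2))))) \<partial>lborel)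
      \<longlonglongrightarrow> (\<integral>t. iexp (- (t * x)) * fourier q t ^ Suc (Suc 0) \<partial>lborel)"
  proof (rule integral_dominated_convergence[where w="\<lambda>t. (norm (fourier q t))\<^sup>2"])
    show "AE t in lborel. (\<lambda>n. iexp (- (t * x)) * (fourier q t * (fourier q t * complex_of_real (exp (- ((?a n)\<^sup>2 * t\<^sup>2 / 2))))))
        \<longlonglongrightarrow> iexp (- (t * x)) * fourier q t ^ Suc (Suc 0)"
    proof (intro AE_I2)
      fix t
      have "(\<lambda>n. iexp (- (t * x)) * (fourier q t * (fourier q t * complex_of_real (exp (- ((?a n)\<^sup>2 * t\<^sup>2 / 2))))))
          \<longlonglongrightarrow> iexp (- (t * x)) * (fourier q t * (fourier q t * complex_of_real 1))"
        by (intro tendsto_intros tendsto_of_real exp_gaussian_tendsto_1)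
      then show "(\<lambda>n. iexp (- (t * x)) * (fourier q t * (fourier q t * complex_of_real (exp (- ((?a n)\<^sup>2 * t\<^sup>2 / 2))))))
          \<longlonglongrightarrow> iexp (- (t * x)) * fourier q t ^ Suc (Suc 0)"
        by simp
    qed
    show "AE t in lborel. norm (iexp (- (t * x)) * (fourier q t * (fourier q t * complex_of_real (exp (- ((?a n)\<^sup>2 * t\<^sup>2 / 2))))))
        \<le> (norm (fourier q t))\<^sup>2" for n
      by (intro AE_I2) (simp add: norm_mult power2_eq_square mult_left_le mult.assoc[symmetric])
  qed (use plancherel_inequality(1)[OF q B] in auto)
  ultimately have "(\<integral>y. complex_of_real (q (x - y)) * complex_of_real (2 * pi * q y) \<partial>lborel)
      = (\<integral>t. iexp (- (t * x)) * fourier q t ^ Suc (Suc 0) \<partial>lborel)"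
    using LIMSEQ_unique by simp
  moreover have "(\<integral>y. complex_of_real (q (x - y)) * complex_of_real (2 * pi * q y) \<partial>lborel)
      = complex_of_real (2 * pi * convolution_power q (Suc (Suc 0)) x)"
    unfolding convolution_power_def fun_convolution_def
    by (simp add: mult.left_commute[of _ "2 * complex_of_real pi"] flip: integral_complex_of_real)
  ultimately show ?case by simp
next
  case (Suc k)
  have "complex_of_real (2 * pi * convolution_power q (Suc (Suc (Suc k))) x)
      = complex_of_real (2 * pi * (\<integral>y. q (x - y) * convolution_power q (Suc (Suc k)) y \<partial>lborel))"
    by (simp add: convolution_power_def fun_convolution_def)
  also have "\<dots> = (\<integral>y. complex_of_real (q (x - y)) * complex_of_real (2 * pi * convolution_power q (Suc (Suc k)) y) \<partial>lborel)"
    by (simp add: mult.left_commute[of _ "2 * complex_of_real pi"] flip: integral_complex_of_real)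
  also have "\<dots> = (\<integral>t. iexp (- (t * x)) * (fourier q t * fourier q t ^ Suc (Suc k)) \<partial>lborel)"
    unfolding Suc by (rule convolution_inverse_fourier[OF q fourier_power_integrable[OF q B]])
  finally show ?case by simp
qed

section \<open>Compound Poisson densities as Fourier integrals\<close>

text \<open>
  The intensity of a Poisson process on the unit interval. The bound \<open>B\<close> is kept explicit because for
  the tilted intensity it grows with \<open>\<beta>\<close> and must be beaten by the decay of the transform.
\<close>

locale bounded_intensity =
  fixes p :: "real \<Rightarrow> real" and B :: real
  assumes p_measurable [measurable]: "p \<in> borel_measurable borel"
    and p_nonneg: "0 \<le> p x"
    and p_le: "p x \<le> B"
    and p_support: "x \<notin> {0..1} \<Longrightarrow> p x = 0"
    and p_continuous: "AE x in lborel. isCont p x"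
begin

definition moment :: "nat \<Rightarrow> real"
  where "moment k = (\<integral>x. x ^ k * p x \<partial>lborel)"

text \<open>
  The defective density of the sum of all arrivals: a Poisson mixture of the convolution powers of the
  normalised intensity, without the atom at \<open>0\<close>.
\<close>

definition compound_density :: "real \<Rightarrow> real"
  where "compound_density x =
    (\<Sum>k. exp (- moment 0) * moment 0 ^ Suc k / fact (Suc k) *
          convolution_power (\<lambda>x. p x / moment 0) (Suc k) x)"

lemma B_nonneg: "0 \<le> B"
  using p_nonneg[of 0] p_le[of 0] by simp

lemma integrable_bounded_mult:
  fixes f :: "real \<Rightarrow> 'b :: {banach, real_normed_field, second_countable_topology}"
  assumes [measurable]: "f \<in> borel_measurable borel" and f: "\<And>x. x \<in> {0..1} \<Longrightarrow> norm (f x) \<le> K"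
  shows "integrable lborel (\<lambda>x. f x * of_real (p x))"
proof (rule Bochner_Integration.integrable_bound)
  show "integrable lborel (\<lambda>x. K * B * indicator {0..1::real} x)"
    by (intro integrable_mult_right integrable_real_indicator) auto
  show "AE x in lborel. norm (f x * of_real (p x)) \<le> norm (K * B * indicator {0..1} x)"
  proof (intro AE_I2)
    fix x :: real
    show "norm (f x * of_real (p x)) \<le> norm (K * B * indicator {0..1} x)"
    proof (cases "x \<in> {0..1}")
      case True
      have K0: "0 \<le> K" using f[OF True] norm_ge_zero order_trans by blast
      have "norm (f x) * p x \<le> K * B"
        using f[OF True] K0 p_nonneg p_le by (intro mult_mono) auto
      then show ?thesis using True K0 B_nonneg p_nonneg by (simp add: norm_mult)
    qed (simp add: p_support)
  qed
qed measurable

lemma integrable_moment: "integrable lborel (\<lambda>x. x ^ k * p x)"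
  using integrable_bounded_mult[of "\<lambda>x. x ^ k" 1] by (simp add: power_le_one)

lemma integrable_p: "integrable lborel p"
  using integrable_moment[of 0] by simp

lemma moment_nonneg: "0 \<le> moment k"
  unfolding moment_def
proof (intro integral_nonneg_AE AE_I2)
  fix x show "0 \<le> x ^ k * p x"
    using p_nonneg p_support[of x] by (cases "x \<in> {0..1}") auto
qed

lemma moment_antimono:
  assumes "k \<le> l" shows "moment l \<le> moment k"
  unfolding moment_def
proof (intro integral_mono integrable_moment)
  fix x show "x ^ l * p x \<le> x ^ k * p x"
    using p_nonneg p_support[of x] power_decreasing[OF assms, of x]
    by (cases "x \<in> {0..1}") (auto intro!: mult_right_mono)
qed

text \<open>
  The Taylor bound of the exponential on the imaginary axis, integrated against the intensity.
\<close>

lemma fourier_taylor: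
  "norm (fourier p t - (\<Sum>k\<le>n. (\<i> * t) ^ k / fact k * moment k)) \<le> \<bar>t\<bar> ^ Suc n / fact (Suc n) * moment (Suc n)"
proof -
  have int1: "integrable lborel (\<lambda>x. iexp (t * x) * complex_of_real (p x))"
    by (rule integrable_bounded_mult[where K=1]) simp_all
  have int2: "integrable lborel (\<lambda>x. (\<i> * t) ^ k / fact k * complex_of_real (x ^ k * p x))" for k
    by (intro integrable_mult_right integrable_of_real integrable_moment)
  have "fourier p t - (\<Sum>k\<le>n. (\<i> * t) ^ k / fact k * moment k)
      = (\<integral>x. iexp (t * x) * complex_of_real (p x) - (\<Sum>k\<le>n. (\<i> * t) ^ k / fact k * complex_of_real (x ^ k * p x)) \<partial>lborel)"
    unfolding fourier_def moment_def integral_complex_of_real[symmetric]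
    by (subst Bochner_Integration.integral_diff)
      (use int1 int2 in \<open>simp_all add: Bochner_Integration.integral_sum del: of_real_mult of_real_power\<close>)
  also have "norm \<dots> \<le> (\<integral>x. norm (iexp (t * x) * complex_of_real (p x) - (\<Sum>k\<le>n. (\<i> * t) ^ k / fact k * complex_of_real (x ^ k * p x))) \<partial>lborel)"
    by (rule integral_norm_bound)
  also have "\<dots> \<le> (\<integral>x. \<bar>t\<bar> ^ Suc n / fact (Suc n) * (x ^ Suc n * p x) \<partial>lborel)"
  proof (rule integral_mono)
    show "integrable lborel (\<lambda>x. norm (iexp (t * x) * complex_of_real (p x) - (\<Sum>k\<le>n. (\<i> * t) ^ k / fact k * complex_of_real (x ^ k * p x))))"
      by (intro integrable_norm Bochner_Integration.integrable_diff int1 Bochner_Integration.integrable_sum int2)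
    show "integrable lborel (\<lambda>x. \<bar>t\<bar> ^ Suc n / fact (Suc n) * (x ^ Suc n * p x))"
      by (intro integrable_mult_right integrable_moment)
    fix x :: real
    have "iexp (t * x) * complex_of_real (p x) - (\<Sum>k\<le>n. (\<i> * t) ^ k / fact k * complex_of_real (x ^ k * p x))
        = (iexp (t * x) - (\<Sum>k\<le>n. (\<i> * complex_of_real (t * x)) ^ k / fact k)) * complex_of_real (p x)"
      by (simp add: right_diff_distrib sum_distrib_left power_mult_distrib mult_ac)
    then have "norm (iexp (t * x) * complex_of_real (p x) - (\<Sum>k\<le>n. (\<i> * t) ^ k / fact k * complex_of_real (x ^ k * p x)))
        = norm (iexp (t * x) - (\<Sum>k\<le>n. (\<i> * complex_of_real (t * x)) ^ k / fact k)) * p x"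
      using p_nonneg by (simp add: norm_mult)
    also have "\<dots> \<le> \<bar>t * x\<bar> ^ Suc n / fact (Suc n) * p x"
      by (intro mult_right_mono iexp_approx1 p_nonneg)
    also have "\<dots> = \<bar>t\<bar> ^ Suc n / fact (Suc n) * (x ^ Suc n * p x)"
      using p_support[of x] by (cases "x \<in> {0..1}") (simp_all add: abs_mult power_mult_distrib)
    finally show "norm (iexp (t * x) * complex_of_real (p x) - (\<Sum>k\<le>n. (\<i> * t) ^ k / fact k * complex_of_real (x ^ k * p x)))
        \<le> \<bar>t\<bar> ^ Suc n / fact (Suc n) * (x ^ Suc n * p x)" .
  qed
  also have "\<dots> = \<bar>t\<bar> ^ Suc n / fact (Suc n) * moment (Suc n)"
    unfolding moment_def by simp
  finally show ?thesis .
qed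

lemma norm_fourier_le_mass: "norm (fourier p t) \<le> moment 0"
  using norm_fourier_le[of p t] p_nonneg by (simp add: moment_def)

lemma plancherel_p:
  shows "integrable lborel (\<lambda>t. (norm (fourier p t))\<^sup>2)"
    and "(\<integral>t. (norm (fourier p t))\<^sup>2 \<partial>lborel) \<le> 2 * pi * B * moment 0"
proof -
  have "\<bar>p x\<bar> \<le> B" for x using p_nonneg p_le by simp
  from plancherel_inequality[OF integrable_p this]
  show "integrable lborel (\<lambda>t. (norm (fourier p t))\<^sup>2)"
    and "(\<integral>t. (norm (fourier p t))\<^sup>2 \<partial>lborel) \<le> 2 * pi * B * moment 0"
    using p_nonneg by (simp_all add: moment_def)
qed

text \<open>
  The characteristic function of the compound Poisson law without the contributions of zero and of one
  arrival, neither of which has an integrable transform in general.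
\<close>

definition compound_transform :: "real \<Rightarrow> complex"
  where "compound_transform t = exp (- moment 0) * (exp (fourier p t) - 1 - fourier p t)"

text \<open>
  Normalising \<open>p\<close> makes its transform at most \<open>1\<close> in modulus, so the transform of every convolution
  power is dominated by that of the square, and the exponential weights allow summation under the integral sign.
\<close>

lemma compound_density_inversion:
  assumes pos: "0 < moment 0"
  shows "integrable lborel compound_transform"
    and "2 * pi * (compound_density x - exp (- moment 0) * p x)
       = Re (\<integral>t. iexp (- (t * x)) * compound_transform t \<partial>lborel)"
proof -
  define lam where "lam = moment 0"
  define q where "q x = p x / lam" for x
  define c where "c k = exp (- lam) * lam ^ Suc (Suc k) / fact (Suc (Suc k))" for k
  have lam: "lam > 0" using pos by (simp add: lam_def)
  have q: "integrable lborel q" unfolding q_def using integrable_p by simp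
  have qB: "\<bar>q x\<bar> \<le> B / lam" for x
    unfolding q_def using p_nonneg p_le lam by (simp add: divide_right_mono)
  have qc: "AE x in lborel. isCont q x"
    using p_continuous by eventually_elim (auto simp: q_def[abs_def] intro!: continuous_intros simp: lam less_imp_neq[OF lam, symmetric])
  have fq: "fourier q t = fourier p t / lam" for t
    using fourier_scale[of "1 / lam" p t] by (simp add: q_def[abs_def])
  have fq1: "norm (fourier q t) \<le> 1" for t
    unfolding fq using norm_fourier_le_mass[of t] lam by (simp add: norm_divide lam_def)
  have c0: "0 \<le> c k" for k using lam by (simp add: c_def)
  have csum: "summable c"
  proof -
    have "summable (\<lambda>k. exp (- lam) * (lam ^ (k + 2) / fact (k + 2)))"
      using summable_ignore_initial_segment[OF summable_exp[of lam], of 2]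
      by (intro summable_mult) (simp add: field_simps)
    then show ?thesis by (simp add: c_def[abs_def])
  qed
  define F where "F k t = iexp (- (t * x)) * (complex_of_real (c k) * fourier q t ^ Suc (Suc k))" for k t
  have pl: "integrable lborel (\<lambda>t. (norm (fourier q t))\<^sup>2)"
    by (rule plancherel_inequality(1)[OF q qB])
  have Fint: "integrable lborel (F k)" for k
    unfolding F_def
    by (intro integrable_inverse_iexp_mult integrable_mult_right fourier_power_integrable[OF q qB])
  have Fle: "norm (F k t) \<le> c k * (norm (fourier q t))\<^sup>2" for k t
  proof -
    have "norm (F k t) = c k * (norm (fourier q t) ^ k * (norm (fourier q t))\<^sup>2)"
      using c0 by (simp add: F_def norm_mult norm_power power2_eq_square mult_ac)
    also have "\<dots> \<le> c k * (1 * (norm (fourier q t))\<^sup>2)"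
      using c0 fq1 by (intro mult_left_mono mult_right_mono power_le_one) auto
    finally show ?thesis by simp
  qed
  have Fsums: "(\<lambda>k. F k t) sums (iexp (- (t * x)) * compound_transform t)" for t
  proof -
    have "(\<lambda>k. fourier p t ^ (k + 2) /\<^sub>R fact (k + 2)) sums (exp (fourier p t) - (\<Sum>k<2. fourier p t ^ k /\<^sub>R fact k))"
      by (intro sums_split_initial_segment exp_converges)
    then have "(\<lambda>k. iexp (- (t * x)) * (exp (- lam) * (fourier p t ^ (k + 2) /\<^sub>R fact (k + 2)))) sums
        (iexp (- (t * x)) * (exp (- lam) * (exp (fourier p t) - (\<Sum>k<2. fourier p t ^ k /\<^sub>R fact k))))"
      by (intro sums_mult)
    moreover have "iexp (- (t * x)) * (exp (- lam) * (fourier p t ^ (k + 2) /\<^sub>R fact (k + 2))) = F k t" for k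
      using lam by (simp add: F_def c_def fq power_divide scaleR_conv_of_real divide_simps exp_of_real)
    moreover have "iexp (- (t * x)) * (exp (- lam) * (exp (fourier p t) - (\<Sum>k<2. fourier p t ^ k /\<^sub>R fact k)))
        = iexp (- (t * x)) * compound_transform t"
      by (simp add: compound_transform_def lam_def numeral_2_eq_2 algebra_simps exp_of_real)
    ultimately show ?thesis by simp
  qed
  have s1: "AE t in lborel. summable (\<lambda>k. norm (F k t))"
  proof (intro AE_I2)
    fix t show "summable (\<lambda>k. norm (F k t))"
      by (rule summable_comparison_test'[OF summable_mult2[OF csum]]) (use Fle in simp)
  qed
  have s2: "summable (\<lambda>k. \<integral>t. norm (F k t) \<partial>lborel)"
  proof (rule summable_comparison_test'[OF summable_mult2[OF csum]])
    fix k :: nat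
    have "(\<integral>t. norm (F k t) \<partial>lborel) \<le> (\<integral>t. c k * (norm (fourier q t))\<^sup>2 \<partial>lborel)"
      by (rule integral_mono) (use Fint pl Fle in auto)
    then show "norm (\<integral>t. norm (F k t) \<partial>lborel) \<le> c k * (\<integral>t. (norm (fourier q t))\<^sup>2 \<partial>lborel)"
      by simp
  qed
  have eqF: "(\<lambda>t. \<Sum>k. F k t) = (\<lambda>t. iexp (- (t * x)) * compound_transform t)"
    using Fsums by (auto simp: sums_iff)
  have "integrable lborel (\<lambda>t. iexp (- (t * x)) * compound_transform t)"
    using integrable_suminf[OF Fint s1 s2] unfolding eqF .
  from integrable_iexp_mult[OF this, of x] show "integrable lborel compound_transform"
    by (simp add: mult.assoc[symmetric] exp_add[symmetric] mult.commute[of x])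
  have "(\<lambda>k. integral\<^sup>L lborel (F k)) sums (\<integral>t. iexp (- (t * x)) * compound_transform t \<partial>lborel)"
    using sums_integral[OF Fint s1 s2] unfolding eqF .
  moreover have "integral\<^sup>L lborel (F k) = complex_of_real (2 * pi * (c k * convolution_power q (Suc (Suc k)) x))" for k
  proof -
    have "integral\<^sup>L lborel (F k) = complex_of_real (c k) * (\<integral>t. iexp (- (t * x)) * fourier q t ^ Suc (Suc k) \<partial>lborel)"
      unfolding F_def mult.left_commute[of _ "complex_of_real (c k)"] by (rule integral_mult_right_zero)
    also have "\<dots> = complex_of_real (c k) * complex_of_real (2 * pi * convolution_power q (Suc (Suc k)) x)"
      unfolding convolution_power_inversion[OF q qB qc] ..
    finally show ?thesis by simp
  qed
  ultimately have "(\<lambda>k. complex_of_real (2 * pi * (c k * convolution_power q (Suc (Suc k)) x))) sums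
      (\<integral>t. iexp (- (t * x)) * compound_transform t \<partial>lborel)"
    by simp
  from sums_Re[OF this]
  have "(\<lambda>k. 2 * pi * (c k * convolution_power q (Suc (Suc k)) x)) sums
      Re (\<integral>t. iexp (- (t * x)) * compound_transform t \<partial>lborel)"
    by (simp only: Re_complex_of_real)
  from sums_mult[OF this, of "1 / (2 * pi)"]
  have "(\<lambda>k. c k * convolution_power q (Suc (Suc k)) x) sums
      (Re (\<integral>t. iexp (- (t * x)) * compound_transform t \<partial>lborel) / (2 * pi))"
    by simp
  then have "(\<lambda>k. exp (- lam) * lam ^ Suc k / fact (Suc k) * convolution_power q (Suc k) x) sums
      (Re (\<integral>t. iexp (- (t * x)) * compound_transform t \<partial>lborel) / (2 * pi)
        + exp (- lam) * lam ^ Suc 0 / fact (Suc 0) * convolution_power q (Suc 0) x)"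
    unfolding c_def by (rule sums_Suc)
  moreover have "exp (- lam) * lam ^ Suc 0 / fact (Suc 0) * convolution_power q (Suc 0) x = exp (- moment 0) * p x"
    using lam by (simp add: convolution_power_def q_def lam_def)
  ultimately have "compound_density x = Re (\<integral>t. iexp (- (t * x)) * compound_transform t \<partial>lborel) / (2 * pi) + exp (- moment 0) * p x"
    unfolding compound_density_def lam_def q_def[abs_def] by (simp add: sums_iff)
  then show "2 * pi * (compound_density x - exp (- moment 0) * p x)
       = Re (\<integral>t. iexp (- (t * x)) * compound_transform t \<partial>lborel)"
    by simp
qed

end

section \<open>Local limit bounds for a fixed intensity\<close>

definition gaussian_abs_moment :: "nat \<Rightarrow> real"
  where "gaussian_abs_moment k = (\<integral>u. \<bar>u\<bar> ^ k * exp (- (u\<^sup>2 / 2)) \<partial>lborel)"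

lemma gaussian_abs_moment_nonneg: "0 \<le> gaussian_abs_moment k"
  unfolding gaussian_abs_moment_def by (intro integral_nonneg_AE AE_I2) simp

text \<open>
  The Gaussian that remains of \<open>exp (- V * t^2 / 2)\<close> when a third of the exponent is given up to pay for
  the exponential of the remainder.
\<close>

definition wide_gaussian :: "real \<Rightarrow> real \<Rightarrow> real"
  where "wide_gaussian V t = exp (- (V * t\<^sup>2 / 3))"

lemma wide_gaussian_moment:
  assumes "V > 0"
  shows "integrable lborel (\<lambda>t. \<bar>t\<bar> ^ k * wide_gaussian V t)"
    and "(\<integral>t. \<bar>t\<bar> ^ k * wide_gaussian V t \<partial>lborel) = gaussian_abs_moment k / sqrt (2 * V / 3) ^ Suc k"
proof -
  define a where "a = sqrt (2 * V / 3)"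
  have a: "a > 0" using assms by (simp add: a_def)
  have "wide_gaussian V t = exp (- (a\<^sup>2 * t\<^sup>2 / 2))" for t
    using assms by (simp add: wide_gaussian_def a_def)
  then show "integrable lborel (\<lambda>t. \<bar>t\<bar> ^ k * wide_gaussian V t)"
    and "(\<integral>t. \<bar>t\<bar> ^ k * wide_gaussian V t \<partial>lborel) = gaussian_abs_moment k / sqrt (2 * V / 3) ^ Suc k"
    using integrable_gaussian[OF a, of k] integral_gaussian_moment[OF a, of k]
    by (simp_all add: gaussian_abs_moment_def a_def)
qed

text \<open>
  The integrals of \<open>\<bar>t\<bar>^3\<close>, \<open>t^4\<close> and \<open>t^6\<close> against \<open>wide_gaussian V\<close>, freed of their powers of \<open>V\<close>. One
  constant is used for both estimates; the factor \<open>2\<close> comes from the estimate at the mean.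
\<close>

definition local_limit_const :: real
  where "local_limit_const = gaussian_abs_moment 3 / sqrt (2 / 3) ^ 4
    + 2 * gaussian_abs_moment 4 / sqrt (2 / 3) ^ 5 + gaussian_abs_moment 6 / sqrt (2 / 3) ^ 7"

lemma local_limit_const_nonneg: "0 \<le> local_limit_const"
  unfolding local_limit_const_def by (simp add: gaussian_abs_moment_nonneg)

lemma gaussian_times_exp_eq_wide: "exp (- (V * t\<^sup>2 / 2)) * exp (V * t\<^sup>2 / 6) = wide_gaussian V t"
  unfolding wide_gaussian_def exp_add[symmetric] by (simp add: field_simps)

context bounded_intensity
begin

text \<open>
  What is left of the cumulant generating function, at the imaginary argument \<open>\<i> * t\<close>, after its first
  and second order terms.
\<close>

definition cumulant_remainder :: "real \<Rightarrow> complex"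
  where "cumulant_remainder t = fourier p t - moment 0 - \<i> * t * moment 1 + t\<^sup>2 * moment 2 / 2"

text \<open>
  All higher moments are at most the second, as the intensity lives on the unit interval.
\<close>

lemma cumulant_remainder_bound:
  "norm (cumulant_remainder t) \<le> \<bar>t\<bar> ^ 3 * moment 2 / 6"
  "norm (cumulant_remainder t + \<i> * t ^ 3 * moment 3 / 6) \<le> t ^ 4 * moment 2 / 24"
proof -
  have "(\<Sum>k\<le>2. (\<i> * t) ^ k / fact k * moment k) = moment 0 + \<i> * t * moment 1 - t\<^sup>2 * moment 2 / 2"
    by (simp add: numeral_2_eq_2 power2_eq_square algebra_simps)
  then have "norm (cumulant_remainder t) \<le> \<bar>t\<bar> ^ 3 / 6 * moment 3"
    using fourier_taylor[of t 2] by (simp add: cumulant_remainder_def algebra_simps eval_nat_numeral fact_numeral)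
  also have "\<dots> \<le> \<bar>t\<bar> ^ 3 / 6 * moment 2"
    by (intro mult_left_mono moment_antimono) auto
  finally show "norm (cumulant_remainder t) \<le> \<bar>t\<bar> ^ 3 * moment 2 / 6" by simp
  have "(\<Sum>k\<le>3. (\<i> * t) ^ k / fact k * moment k)
      = moment 0 + \<i> * t * moment 1 - t\<^sup>2 * moment 2 / 2 - \<i> * t ^ 3 * moment 3 / 6"
    by (simp add: eval_nat_numeral fact_numeral algebra_simps)
  then have "norm (cumulant_remainder t + \<i> * t ^ 3 * moment 3 / 6) \<le> \<bar>t\<bar> ^ 4 / 24 * moment 4"
    using fourier_taylor[of t 3] by (simp add: cumulant_remainder_def algebra_simps eval_nat_numeral fact_numeral)
  also have "\<dots> \<le> \<bar>t\<bar> ^ 4 / 24 * moment 2"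
    by (intro mult_left_mono moment_antimono) auto
  finally show "norm (cumulant_remainder t + \<i> * t ^ 3 * moment 3 / 6) \<le> t ^ 4 * moment 2 / 24" by simp
qed

text \<open>
  The share in the centred transform of the two removed terms, zero and one arrival.
\<close>

definition defect :: "real \<Rightarrow> complex"
  where "defect t = iexp (- (t * moment 1)) * (- (exp (- moment 0) * (1 + fourier p t)))"

text \<open>
  The transform of the centred density minus that of the normal density with the same variance.
\<close>

definition transform_error :: "real \<Rightarrow> complex"
  where "transform_error t = iexp (- (t * moment 1)) * compound_transform t - exp (- (moment 2 * t\<^sup>2 / 2))"

lemma norm_defect: "norm (defect t) \<le> exp (- moment 0) * (1 + moment 0)"
proof -
  have "norm (1 + fourier p t) \<le> 1 + moment 0"
    using norm_triangle_ineq[of 1 "fourier p t"] norm_fourier_le_mass[of t] by simp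
  then show ?thesis by (simp add: defect_def norm_mult)
qed

lemma transform_error_eq:
  "transform_error t = exp (- (moment 2 * t\<^sup>2 / 2)) * (exp (cumulant_remainder t) - 1) + defect t"
proof -
  have "iexp (- (t * moment 1)) * (exp (- moment 0) * exp (fourier p t))
      = exp (- (moment 2 * t\<^sup>2 / 2)) * exp (cumulant_remainder t)"
    unfolding exp_of_real exp_add[symmetric] cumulant_remainder_def
    by (simp add: algebra_simps exp_of_real[symmetric] flip: exp_add)
  then show ?thesis
    unfolding transform_error_def compound_transform_def defect_def by (simp add: algebra_simps)
qed

text \<open>
  On \<open>\<bar>t\<bar> \<le> 1\<close> the cubic remainder is at most \<open>V * t^2 / 6\<close>, so it can be absorbed by the Gaussian. The
  first bound is \<open>\<bar>exp w - 1\<bar> \<le> \<bar>w\<bar> * exp \<bar>w\<bar>\<close> for the remainder \<open>w\<close>. In the second the odd cubic term is compensated first;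
  what remains is the quartic part of \<open>w\<close> and the quadratic term \<open>\<bar>w\<bar>^2\<close>, of order \<open>t^6\<close>.
\<close>

lemma transform_error_middle:
  assumes t: "\<bar>t\<bar> \<le> 1"
  shows "norm (transform_error t) \<le> \<bar>t\<bar> ^ 3 * moment 2 * wide_gaussian (moment 2) t + exp (- moment 0) * (1 + moment 0)"
    and "norm (transform_error t + \<i> * t ^ 3 * moment 3 / 6 * exp (- (moment 2 * t\<^sup>2 / 2)))
      \<le> t ^ 4 * moment 2 * wide_gaussian (moment 2) t
       + t ^ 6 * (moment 2)\<^sup>2 * wide_gaussian (moment 2) t + exp (- moment 0) * (1 + moment 0)"
proof -
  define w where "w = cumulant_remainder t"
  define V where "V = moment 2"
  define G where "G = exp (- (V * t\<^sup>2 / 2))"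
  have V: "0 \<le> V" by (simp add: V_def moment_nonneg)
  have w1: "norm w \<le> \<bar>t\<bar> ^ 3 * V / 6"
    using cumulant_remainder_bound(1)[of t] by (simp add: w_def V_def)
  have t3: "\<bar>t\<bar> ^ 3 \<le> t\<^sup>2"
    using power_decreasing[of 2 3 "\<bar>t\<bar>"] t by simp
  have w2: "norm w \<le> V * t\<^sup>2 / 6"
    using w1 mult_right_mono[OF t3 V] by (simp add: mult.commute)
  have Gw: "G * exp (norm w) \<le> wide_gaussian V t"
    unfolding gaussian_times_exp_eq_wide[symmetric] G_def using w2 by (intro mult_left_mono) auto
  have GW: "G \<le> wide_gaussian V t"
    using V by (simp add: G_def wide_gaussian_def mult_right_mono)
  have "norm (G * (exp w - 1)) \<le> G * (exp (norm w) * norm w)"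
    using Taylor_exp_field[of w 0] by (simp add: norm_mult G_def)
  also have "\<dots> = (G * exp (norm w)) * norm w" by simp
  also have "\<dots> \<le> wide_gaussian V t * (\<bar>t\<bar> ^ 3 * V / 6)"
    using V by (intro mult_mono Gw w1) (auto simp: wide_gaussian_def)
  also have "\<dots> \<le> \<bar>t\<bar> ^ 3 * V * wide_gaussian V t"
    using V by (simp add: wide_gaussian_def)
  finally show "norm (transform_error t) \<le> \<bar>t\<bar> ^ 3 * moment 2 * wide_gaussian (moment 2) t + exp (- moment 0) * (1 + moment 0)"
    unfolding transform_error_eq using norm_defect[of t]
    by (intro order_trans[OF norm_triangle_ineq] add_mono) (auto simp: w_def V_def G_def)
  have "norm (G * (exp w - 1 - w)) \<le> G * (exp (norm w) * (norm w)\<^sup>2)"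
  proof -
    have "norm (exp w - 1 - w) \<le> exp (norm w) * (norm w)\<^sup>2"
      using Taylor_exp_field[of w 1] by (simp add: power2_eq_square algebra_simps)
    then show ?thesis
      by (simp add: norm_mult G_def)
  qed
  also have "\<dots> = (G * exp (norm w)) * (norm w)\<^sup>2" by simp
  also have "\<dots> \<le> wide_gaussian V t * (\<bar>t\<bar> ^ 3 * V / 6)\<^sup>2"
    by (intro mult_mono Gw power_mono w1) (auto simp: wide_gaussian_def)
  also have "(\<bar>t\<bar> ^ 3 * V / 6)\<^sup>2 = t ^ 6 * V\<^sup>2 / 36"
    by (simp add: power_mult_distrib power_divide flip: power_mult)
  also have "wide_gaussian V t * (t ^ 6 * V\<^sup>2 / 36) \<le> t ^ 6 * V\<^sup>2 * wide_gaussian V t"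
    by (simp add: wide_gaussian_def)
  finally have 1: "norm (G * (exp w - 1 - w)) \<le> t ^ 6 * V\<^sup>2 * wide_gaussian V t" .
  have "norm (G * (w + \<i> * t ^ 3 * moment 3 / 6)) \<le> G * (t ^ 4 * V / 24)"
    using cumulant_remainder_bound(2)[of t] by (simp add: norm_mult G_def w_def V_def)
  also have "\<dots> \<le> wide_gaussian V t * (t ^ 4 * V)"
    using V by (intro mult_mono GW) (auto simp: wide_gaussian_def)
  finally have 2: "norm (G * (w + \<i> * t ^ 3 * moment 3 / 6)) \<le> t ^ 4 * V * wide_gaussian V t"
    by (simp add: mult_ac)
  have "transform_error t + \<i> * t ^ 3 * moment 3 / 6 * G
      = G * (w + \<i> * t ^ 3 * moment 3 / 6) + G * (exp w - 1 - w) + defect t"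
    unfolding transform_error_eq G_def w_def V_def by (simp add: algebra_simps)
  also have "norm \<dots> \<le> t ^ 4 * V * wide_gaussian V t + t ^ 6 * V\<^sup>2 * wide_gaussian V t + exp (- moment 0) * (1 + moment 0)"
    by (intro order_trans[OF norm_triangle_ineq] add_mono 1 2 norm_defect)
  finally show "norm (transform_error t + \<i> * t ^ 3 * moment 3 / 6 * exp (- (moment 2 * t\<^sup>2 / 2)))
      \<le> t ^ 4 * moment 2 * wide_gaussian (moment 2) t
       + t ^ 6 * (moment 2)\<^sup>2 * wide_gaussian (moment 2) t + exp (- moment 0) * (1 + moment 0)"
    by (simp add: G_def V_def)
qed

text \<open>
  Here the two transforms are estimated separately. The normal one and the compensating cubic term are
  absorbed into \<open>t^4 * V * wide_gaussian V t\<close>, where \<open>t^4 * V \<ge> 1\<close>, so that both ranges of \<open>t\<close> share one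
  majorant.
\<close>

lemma transform_error_tail:
  assumes t: "1 < \<bar>t\<bar>" and V: "1 \<le> moment 2"
    and gap: "\<bar>Re (fourier p t)\<bar> \<le> moment 0 - \<kappa>"
  shows "norm (transform_error t) \<le> t ^ 4 * moment 2 * wide_gaussian (moment 2) t + exp (- \<kappa>) * (norm (fourier p t))\<^sup>2"
    and "norm (\<i> * t ^ 3 * moment 3 / 6 * exp (- (moment 2 * t\<^sup>2 / 2))) \<le> t ^ 4 * moment 2 * wide_gaussian (moment 2) t"
proof -
  define \<psi> where "\<psi> = fourier p t"
  have GW: "exp (- (moment 2 * t\<^sup>2 / 2)) \<le> wide_gaussian (moment 2) t"
    using V by (simp add: wide_gaussian_def mult_right_mono)
  have t34: "\<bar>t\<bar> ^ 3 \<le> t ^ 4"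
    using power_increasing[of 3 4 "\<bar>t\<bar>"] t by simp
  have t4: "1 \<le> t ^ 4"
    using one_le_power[of "\<bar>t\<bar>" 4] t by simp
  have "norm (exp \<psi> - 1 - \<psi>) \<le> exp \<bar>Re \<psi>\<bar> * (norm \<psi>)\<^sup>2"
    using Taylor_exp[of \<psi> 1] by (simp add: power2_eq_square algebra_simps)
  also have "\<dots> \<le> exp (moment 0 - \<kappa>) * (norm \<psi>)\<^sup>2"
    using gap by (intro mult_right_mono) (auto simp: \<psi>_def)
  finally have "exp (- moment 0) * norm (exp \<psi> - 1 - \<psi>) \<le> exp (- moment 0) * (exp (moment 0 - \<kappa>) * (norm \<psi>)\<^sup>2)"
    by (intro mult_left_mono) auto
  also have "\<dots> = exp (- \<kappa>) * (norm \<psi>)\<^sup>2"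
    by (simp add: mult.assoc[symmetric] exp_add[symmetric])
  finally have 1: "norm (iexp (- (t * moment 1)) * compound_transform t) \<le> exp (- \<kappa>) * (norm \<psi>)\<^sup>2"
    by (simp add: compound_transform_def norm_mult \<psi>_def)
  have "1 * 1 \<le> t ^ 4 * moment 2" by (intro mult_mono t4 V) auto
  then have 2: "exp (- (moment 2 * t\<^sup>2 / 2)) \<le> t ^ 4 * moment 2 * wide_gaussian (moment 2) t"
    using mult_mono[of 1 "t ^ 4 * moment 2" _ "wide_gaussian (moment 2) t"] GW by auto
  have "norm (transform_error t) \<le> norm (iexp (- (t * moment 1)) * compound_transform t) + exp (- (moment 2 * t\<^sup>2 / 2))"
    unfolding transform_error_def by (rule order_trans[OF norm_triangle_ineq4]) simp
  then show "norm (transform_error t) \<le> t ^ 4 * moment 2 * wide_gaussian (moment 2) t + exp (- \<kappa>) * (norm (fourier p t))\<^sup>2"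
    using 1 2 by (simp add: \<psi>_def)
  have "moment 3 / 6 \<le> moment 2"
    using moment_antimono[of 2 3] moment_nonneg[of 3] by simp
  then have "\<bar>t\<bar> ^ 3 * (moment 3 / 6) * exp (- (moment 2 * t\<^sup>2 / 2)) \<le> t ^ 4 * moment 2 * wide_gaussian (moment 2) t"
    using moment_nonneg[of 3] V by (intro mult_mono t34 GW) (auto simp: wide_gaussian_def)
  then show "norm (\<i> * t ^ 3 * moment 3 / 6 * exp (- (moment 2 * t\<^sup>2 / 2))) \<le> t ^ 4 * moment 2 * wide_gaussian (moment 2) t"
    using moment_nonneg[of 3] by (simp add: norm_mult norm_divide norm_power)
qed

lemma remainder_integral_bound:
  assumes V: "1 \<le> moment 2" and [measurable]: "f \<in> borel_measurable borel"
    and pos: "0 \<le> c3" "0 \<le> c4" "0 \<le> c6"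
    and f: "\<And>t. norm (f t) \<le> c3 * (\<bar>t\<bar> ^ 3 * moment 2 * wide_gaussian (moment 2) t)
       + c4 * (t ^ 4 * moment 2 * wide_gaussian (moment 2) t)
       + c6 * (t ^ 6 * (moment 2)\<^sup>2 * wide_gaussian (moment 2) t)
       + exp (- moment 0) * (1 + moment 0) * indicator {-1..1} t
       + exp (- \<kappa>) * (norm (fourier p t))\<^sup>2"
  shows "integrable lborel (f :: real \<Rightarrow> complex)"
    and "sqrt (moment 2) * (\<integral>t. norm (f t) \<partial>lborel)
      \<le> c3 * (gaussian_abs_moment 3 / sqrt (2 / 3) ^ 4) / sqrt (moment 2)
       + (c4 * (gaussian_abs_moment 4 / sqrt (2 / 3) ^ 5) + c6 * (gaussian_abs_moment 6 / sqrt (2 / 3) ^ 7)) / moment 2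
       + 2 * pi * sqrt (moment 2) * (exp (- moment 0) * (1 + moment 0) + exp (- \<kappa>) * B * moment 0)"
proof -
  define V where "V = moment 2"
  define s where "s = sqrt V"
  define r where "r = sqrt (2 / 3 :: real)"
  have V0: "V > 0" using V by (simp add: V_def)
  have s0: "s > 0" and Vs: "V = s\<^sup>2" using V0 by (simp_all add: s_def)
  have r0: "r > 0" by (simp add: r_def)
  have rs: "sqrt (2 * V / 3) = r * s"
    by (simp add: r_def s_def real_sqrt_mult[symmetric])
  let ?m = gaussian_abs_moment and ?W = "wide_gaussian V"
  let ?e = "exp (- moment 0) * (1 + moment 0)"
  let ?h3 = "\<lambda>t. c3 * V * (\<bar>t\<bar> ^ 3 * ?W t)"
  let ?h4 = "\<lambda>t. c4 * V * (\<bar>t\<bar> ^ 4 * ?W t)"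
  let ?h6 = "\<lambda>t. c6 * V\<^sup>2 * (\<bar>t\<bar> ^ 6 * ?W t)"
  let ?h = "\<lambda>t. ?h3 t + ?h4 t + ?h6 t + ?e * indicator {-1..1} t + exp (- \<kappa>) * (norm (fourier p t))\<^sup>2"
  have i1: "integrable lborel ?h3" "integrable lborel ?h4" "integrable lborel ?h6"
    by (rule integrable_mult_right, rule wide_gaussian_moment(1)[OF V0])+
  have i2: "integrable lborel (\<lambda>t::real. ?e * indicator {-1..1} t)"
    "integrable lborel (\<lambda>t. exp (- \<kappa>) * (norm (fourier p t))\<^sup>2)"
    by (auto intro!: integrable_mult_right plancherel_p integrable_real_indicator)
  note i = i1 i2
  have hint: "integrable lborel ?h"
    by (intro Bochner_Integration.integrable_add i)
  have fh: "norm (f t) \<le> ?h t" for t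
    using f[of t] by (simp add: V_def mult_ac)
  show fint: "integrable lborel f"
  proof (rule Bochner_Integration.integrable_bound[OF hint])
    show "AE t in lborel. norm (f t) \<le> norm (?h t)"
      by (intro AE_I2 order_trans[OF fh]) (simp only: real_norm_def abs_ge_self)
  qed measurable
  have "(\<integral>t. norm (f t) \<partial>lborel) \<le> (\<integral>t. ?h t \<partial>lborel)"
    by (rule integral_mono[OF integrable_norm[OF fint] hint fh])
  also have "\<dots> = (\<integral>t. ?h3 t \<partial>lborel) + (\<integral>t. ?h4 t \<partial>lborel) + (\<integral>t. ?h6 t \<partial>lborel)
      + (\<integral>t. ?e * indicator {-1..1::real} t \<partial>lborel) + (\<integral>t. exp (- \<kappa>) * (norm (fourier p t))\<^sup>2 \<partial>lborel)"
    using i by (simp only: Bochner_Integration.integral_add Bochner_Integration.integrable_add)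
  also have "(\<integral>t. ?h3 t \<partial>lborel) = c3 * V * (?m 3 / (r * s) ^ 4)"
    using wide_gaussian_moment(2)[OF V0, of 3] by (simp add: rs)
  also have "(\<integral>t. ?h4 t \<partial>lborel) = c4 * V * (?m 4 / (r * s) ^ 5)"
    using wide_gaussian_moment(2)[OF V0, of 4] by (simp only: rs) simp
  also have "(\<integral>t. ?h6 t \<partial>lborel) = c6 * V\<^sup>2 * (?m 6 / (r * s) ^ 7)"
    using wide_gaussian_moment(2)[OF V0, of 6] by (simp only: rs) simp
  also have "(\<integral>t. ?e * indicator {-1..1::real} t \<partial>lborel) = ?e * 2" by simp
  also have "(\<integral>t. exp (- \<kappa>) * (norm (fourier p t))\<^sup>2 \<partial>lborel) = exp (- \<kappa>) * (\<integral>t. (norm (fourier p t))\<^sup>2 \<partial>lborel)"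
    by simp
  finally have "s * (\<integral>t. norm (f t) \<partial>lborel)
      \<le> s * (c3 * V * (?m 3 / (r * s) ^ 4) + c4 * V * (?m 4 / (r * s) ^ 5) + c6 * V\<^sup>2 * (?m 6 / (r * s) ^ 7)
        + ?e * 2 + exp (- \<kappa>) * (\<integral>t. (norm (fourier p t))\<^sup>2 \<partial>lborel))"
    using s0 by (intro mult_left_mono) auto
  also have "\<dots> \<le> s * (c3 * V * (?m 3 / (r * s) ^ 4) + c4 * V * (?m 4 / (r * s) ^ 5) + c6 * V\<^sup>2 * (?m 6 / (r * s) ^ 7)
        + ?e * (2 * pi) + exp (- \<kappa>) * (2 * pi * B * moment 0))"
    using s0 pi_gt3 moment_nonneg[of 0] by (intro mult_left_mono add_mono order_refl plancherel_p) auto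
  also have "\<dots> = c3 * (?m 3 / r ^ 4) / s + (c4 * (?m 4 / r ^ 5) + c6 * (?m 6 / r ^ 7)) / V
       + 2 * pi * s * (?e + exp (- \<kappa>) * B * moment 0)"
  proof -
    have "s * (c3 * V * (?m 3 / (r * s) ^ 4)) = c3 * (?m 3 / r ^ 4) / s"
      using s0 r0 by (simp add: Vs field_simps eval_nat_numeral)
    moreover have "s * (c4 * V * (?m 4 / (r * s) ^ 5)) = c4 * (?m 4 / r ^ 5) / V"
      using s0 r0 by (simp add: Vs field_simps eval_nat_numeral)
    moreover have "s * (c6 * V\<^sup>2 * (?m 6 / (r * s) ^ 7)) = c6 * (?m 6 / r ^ 7) / V"
      using s0 r0 by (simp add: Vs field_simps eval_nat_numeral)
    ultimately show ?thesis
      by (simp only: distrib_left add_divide_distrib) (simp add: algebra_simps)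
  qed
  finally show "sqrt (moment 2) * (\<integral>t. norm (f t) \<partial>lborel)
      \<le> c3 * (?m 3 / sqrt (2 / 3) ^ 4) / sqrt (moment 2)
       + (c4 * (?m 4 / sqrt (2 / 3) ^ 5) + c6 * (?m 6 / sqrt (2 / 3) ^ 7)) / moment 2
       + 2 * pi * sqrt (moment 2) * (?e + exp (- \<kappa>) * B * moment 0)"
    by (simp add: s_def V_def r_def)
qed

lemma compound_transform_measurable [measurable]: "compound_transform \<in> borel_measurable borel"
  unfolding compound_transform_def by measurable

lemma transform_error_measurable [measurable]: "transform_error \<in> borel_measurable borel"
  unfolding transform_error_def by measurable

text \<open>
  The centred inversion integral of \<open>transform_error\<close>: the normal density is itself the inverse transform
  of a Gaussian, so the two inversion integrals can be subtracted before anything is estimated.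
\<close>

lemma standardized_density_eq:
  assumes pos: "0 < moment 0" and V: "1 \<le> moment 2"
    and x: "x = sqrt (moment 2) * y + moment 1"
    and int: "integrable lborel transform_error"
  shows "2 * pi * (sqrt (moment 2) * compound_density x - std_normal_density y)
    = 2 * pi * (sqrt (moment 2) * (exp (- moment 0) * p x))
      + sqrt (moment 2) * Re (\<integral>t. iexp (- (t * (sqrt (moment 2) * y))) * transform_error t \<partial>lborel)"
proof -
  define s where "s = sqrt (moment 2)"
  have s: "s > 0" "s\<^sup>2 = moment 2" using V by (simp_all add: s_def)
  have split: "iexp (- (t * (s * y))) * transform_error t
      = iexp (- (t * x)) * compound_transform t - iexp (- (t * (s * y))) * complex_of_real (exp (- (s\<^sup>2 * t\<^sup>2 / 2)))" for t
  proof -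
    have "iexp (- (t * (s * y))) * iexp (- (t * moment 1)) = iexp (- (t * x))"
      by (simp add: exp_add[symmetric] x s_def algebra_simps)
    then show ?thesis
      unfolding transform_error_def s(2) by (simp only: right_diff_distrib mult.assoc[symmetric])
  qed
  have "(\<integral>t. iexp (- (t * (s * y))) * transform_error t \<partial>lborel)
      = (\<integral>t. iexp (- (t * x)) * compound_transform t \<partial>lborel) - complex_of_real (2 * pi / s * std_normal_density (s * y / s))"
    unfolding split fourier_gaussian[OF s(1), symmetric]
    by (intro Bochner_Integration.integral_diff integrable_inverse_iexp_mult compound_density_inversion[OF pos]
        integrable_gaussian_complex s)
  then have "Re (\<integral>t. iexp (- (t * (s * y))) * transform_error t \<partial>lborel)
      = 2 * pi * (compound_density x - exp (- moment 0) * p x) - 2 * pi / s * std_normal_density y"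
    unfolding compound_density_inversion(2)[OF pos] using s by (simp only: minus_complex.sel Re_complex_of_real) simp
  then have "s * Re (\<integral>t. iexp (- (t * (s * y))) * transform_error t \<partial>lborel)
      = s * (2 * pi * (compound_density x - exp (- moment 0) * p x)) - 2 * pi * std_normal_density y"
    using s by (simp add: right_diff_distrib)
  then show ?thesis
    unfolding s_def[symmetric] by (simp add: algebra_simps)
qed

text \<open>
  The cancellation behind the faster rate at the mean.
\<close>

lemma odd_term:
  assumes V: "1 \<le> moment 2"
  shows "integrable lborel (\<lambda>t. \<i> * complex_of_real (t ^ 3) * moment 3 / 6 * exp (- (moment 2 * t\<^sup>2 / 2)))" (is "integrable _ ?f")
    and "(\<integral>t. \<i> * complex_of_real (t ^ 3) * moment 3 / 6 * exp (- (moment 2 * t\<^sup>2 / 2)) \<partial>lborel) = 0"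
proof -
  have s: "sqrt (moment 2) > 0" "(sqrt (moment 2))\<^sup>2 = moment 2" using V by simp_all
  show "integrable lborel ?f"
    by (rule Bochner_Integration.integrable_bound[OF integrable_mult_right[OF integrable_gaussian[OF s(1), of 3], of "moment 3 / 6"]])
      (auto simp: norm_mult norm_divide norm_power s(2) abs_mult)
  have "integral\<^sup>L lborel ?f = (\<integral>t. ?f (0 + (-1) * t) \<partial>lborel)"
    by (subst lborel_integral_real_affine[where c="-1" and t=0]) simp_all
  also have "\<dots> = (\<integral>t. - ?f t \<partial>lborel)"
    by (intro Bochner_Integration.integral_cong refl) simp
  finally show "integral\<^sup>L lborel ?f = 0"
    by simp
qed

text \<open>
  The local limit theorem with explicit error. At a general point the modulus of the integrand is
  integrated and the cubic term dominates. At the mean the integrand is not multiplied by an oscillating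
  factor, so the cubic term may be added for free and cancels the leading error. The remainder \<open>R\<close> collects
  everything that is exponentially small.
\<close>

theorem local_limit_bounds:
  assumes V: "1 \<le> moment 2"
    and gap: "\<And>t. 1 < \<bar>t\<bar> \<Longrightarrow> \<bar>Re (fourier p t)\<bar> \<le> moment 0 - \<kappa>"
  defines "R \<equiv> sqrt (moment 2) * (exp (- moment 0) * (B + 1 + moment 0) + exp (- \<kappa>) * B * moment 0)"
  shows "\<bar>sqrt (moment 2) * compound_density (sqrt (moment 2) * y + moment 1) - std_normal_density y\<bar>
      \<le> local_limit_const / sqrt (moment 2) + R"
    and "\<bar>sqrt (moment 2) * compound_density (moment 1) - std_normal_density 0\<bar>
      \<le> local_limit_const / moment 2 + R"
proof -
  define s where "s = sqrt (moment 2)"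
  define A3 where "A3 = gaussian_abs_moment 3 / sqrt (2 / 3) ^ 4"
  define A4 where "A4 = gaussian_abs_moment 4 / sqrt (2 / 3) ^ 5"
  define A6 where "A6 = gaussian_abs_moment 6 / sqrt (2 / 3) ^ 7"
  define S where "S = exp (- moment 0) * (1 + moment 0) + exp (- \<kappa>) * B * moment 0"
  have A: "0 \<le> A3" "0 \<le> A4" "0 \<le> A6" "local_limit_const = A3 + 2 * A4 + A6"
    by (simp_all add: A3_def A4_def A6_def local_limit_const_def gaussian_abs_moment_nonneg)
  have s1: "1 \<le> s" using V by (simp add: s_def)
  have sV: "s \<le> moment 2"
    using mult_left_mono[OF s1, of s] s1 V by (simp add: s_def)
  have pos: "0 < moment 0" using V moment_antimono[of 0 2] by simp
  have S0: "0 \<le> S" using pos B_nonneg by (simp add: S_def)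
  let ?odd = "\<lambda>t. \<i> * complex_of_real (t ^ 3) * moment 3 / 6 * exp (- (moment 2 * t\<^sup>2 / 2))"
  let ?W = "wide_gaussian (moment 2)"
  have W0: "0 \<le> ?W t" for t by (simp add: wide_gaussian_def)
  have b1: "norm (transform_error t) \<le> 1 * (\<bar>t\<bar> ^ 3 * moment 2 * ?W t)
       + 1 * (t ^ 4 * moment 2 * ?W t) + 0 * (t ^ 6 * (moment 2)\<^sup>2 * ?W t)
       + exp (- moment 0) * (1 + moment 0) * indicator {-1..1} t
       + exp (- \<kappa>) * (norm (fourier p t))\<^sup>2" for t
  proof (cases "\<bar>t\<bar> \<le> 1")
    case True
    have "0 \<le> t ^ 4 * moment 2 * ?W t" "0 \<le> exp (- \<kappa>) * (norm (fourier p t))\<^sup>2"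
      using V W0 by simp_all
    moreover have "indicator {-1..1} t = (1::real)" using True by (simp add: abs_le_iff)
    ultimately show ?thesis using transform_error_middle(1)[OF True] by (simp only: mult_1_left mult_zero_left mult_1_right mult_zero_right; linarith)
  next
    case False
    have "0 \<le> \<bar>t\<bar> ^ 3 * moment 2 * ?W t"
      using V W0 by simp
    moreover have "indicator {-1..1} t = (0::real)" using False by (auto simp add: indicator_def abs_le_iff)
    ultimately show ?thesis using transform_error_tail(1)[OF _ V gap, of t] False by simp
  qed
  have i1: "integrable lborel transform_error"
    by (rule remainder_integral_bound(1)[OF V transform_error_measurable _ _ _ b1]) simp_all
  have "s * (\<integral>t. norm (transform_error t) \<partial>lborel) \<le> 1 * A3 / s + (1 * A4 + 0 * A6) / moment 2 + 2 * pi * s * S"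
    unfolding s_def A3_def A4_def A6_def S_def
    by (rule remainder_integral_bound(2)[OF V transform_error_measurable _ _ _ b1]) simp_all
  then have i1': "s * (\<integral>t. norm (transform_error t) \<partial>lborel) \<le> A3 / s + A4 / moment 2 + 2 * pi * s * S"
    by simp
  have b2: "norm (transform_error t + ?odd t) \<le> 0 * (\<bar>t\<bar> ^ 3 * moment 2 * ?W t)
       + 2 * (t ^ 4 * moment 2 * ?W t) + 1 * (t ^ 6 * (moment 2)\<^sup>2 * ?W t)
       + exp (- moment 0) * (1 + moment 0) * indicator {-1..1} t
       + exp (- \<kappa>) * (norm (fourier p t))\<^sup>2" for t
  proof (cases "\<bar>t\<bar> \<le> 1")
    case True
    have "0 \<le> t ^ 4 * moment 2 * ?W t" "0 \<le> exp (- \<kappa>) * (norm (fourier p t))\<^sup>2"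
      using V W0 by simp_all
    moreover have "indicator {-1..1} t = (1::real)" using True by (simp add: abs_le_iff)
    ultimately show ?thesis using transform_error_middle(2)[OF True] by (simp only: mult_1_left mult_zero_left mult_1_right mult_zero_right; linarith)
  next
    case False
    have "0 \<le> t ^ 6 * (moment 2)\<^sup>2 * ?W t"
      using V W0 by simp
    moreover have "indicator {-1..1} t = (0::real)" using False by (auto simp add: indicator_def abs_le_iff)
    moreover have "norm (transform_error t + ?odd t) \<le> norm (transform_error t) + norm (?odd t)"
      by (rule norm_triangle_ineq)
    ultimately show ?thesis
      using transform_error_tail[OF _ V gap, of t] False by simp
  qed
  have om: "(\<lambda>t. transform_error t + ?odd t) \<in> borel_measurable borel" by measurable
  have "s * (\<integral>t. norm (transform_error t + ?odd t) \<partial>lborel) \<le> 0 * A3 / s + (2 * A4 + 1 * A6) / moment 2 + 2 * pi * s * S"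
    unfolding s_def A3_def A4_def A6_def S_def
    by (rule remainder_integral_bound(2)[OF V om _ _ _ b2]) simp_all
  then have i2: "s * (\<integral>t. norm (transform_error t + ?odd t) \<partial>lborel) \<le> (2 * A4 + A6) / moment 2 + 2 * pi * s * S"
    by simp
  \<comment> \<open>The passage from a bound on the Fourier integral to one on the density; both claims only need \<open>K' \<le> K\<close>.\<close>
  have final: "\<bar>s * compound_density x - std_normal_density y\<bar> \<le> K + R"
    if x: "x = s * y + moment 1" and bd: "s * norm (\<integral>t. iexp (- (t * (s * y))) * transform_error t \<partial>lborel) \<le> K' + 2 * pi * s * S"
      and K: "K' \<le> 2 * pi * K" for x y K K'
  proof -
    have "2 * pi * \<bar>s * compound_density x - std_normal_density y\<bar>
        = \<bar>2 * pi * (s * compound_density x - std_normal_density y)\<bar>"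
      by (simp only: abs_mult) simp
    also have "\<dots> \<le> \<bar>2 * pi * (s * (exp (- moment 0) * p x))\<bar>
        + \<bar>s * Re (\<integral>t. iexp (- (t * (s * y))) * transform_error t \<partial>lborel)\<bar>"
      unfolding s_def
      by (subst standardized_density_eq[OF pos V x[unfolded s_def] i1]) (rule abs_triangle_ineq)
    also have "\<dots> \<le> 2 * pi * (s * (exp (- moment 0) * B)) + (2 * pi * K + 2 * pi * s * S)"
    proof (rule add_mono)
      show "\<bar>2 * pi * (s * (exp (- moment 0) * p x))\<bar> \<le> 2 * pi * (s * (exp (- moment 0) * B))"
        using s1 p_nonneg p_le by (simp add: abs_mult)
      have "\<bar>s * Re (\<integral>t. iexp (- (t * (s * y))) * transform_error t \<partial>lborel)\<bar>
          \<le> s * norm (\<integral>t. iexp (- (t * (s * y))) * transform_error t \<partial>lborel)"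
        using s1 abs_Re_le_cmod by (simp add: abs_mult)
      then show "\<bar>s * Re (\<integral>t. iexp (- (t * (s * y))) * transform_error t \<partial>lborel)\<bar> \<le> 2 * pi * K + 2 * pi * s * S"
        using bd K by linarith
    qed
    also have "\<dots> = 2 * pi * (K + R)"
      by (simp add: R_def S_def s_def algebra_simps)
    finally show ?thesis by simp
  qed
  have norm_le: "norm (\<integral>t. iexp (- (t * z)) * transform_error t \<partial>lborel) \<le> (\<integral>t. norm (transform_error t) \<partial>lborel)" for z
    using integral_norm_bound[of lborel "\<lambda>t. iexp (- (t * z)) * transform_error t"] by (simp add: norm_mult)
  show "\<bar>sqrt (moment 2) * compound_density (sqrt (moment 2) * y + moment 1) - std_normal_density y\<bar>
      \<le> local_limit_const / sqrt (moment 2) + R"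
    unfolding s_def[symmetric]
  proof (rule final[OF refl])
    show "s * norm (\<integral>t. iexp (- (t * (s * y))) * transform_error t \<partial>lborel) \<le> (A3 / s + A4 / moment 2) + 2 * pi * s * S"
      by (rule order_trans[OF mult_left_mono[OF norm_le] i1']) (use s1 in simp)
    have "A4 / moment 2 \<le> A4 / s"
      using A s1 sV by (intro divide_left_mono) auto
    moreover have "0 \<le> (A4 + A6) / s"
      using A s1 by simp
    ultimately have "A3 / s + A4 / moment 2 \<le> A3 / s + A4 / s + (A4 + A6) / s"
      by linarith
    also have "\<dots> = 1 * ((A3 + 2 * A4 + A6) / s)"
      by (simp add: add_divide_distrib)
    also have "\<dots> \<le> 2 * pi * ((A3 + 2 * A4 + A6) / s)"
      using A s1 pi_gt3 by (intro mult_right_mono) auto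
    finally show "A3 / s + A4 / moment 2 \<le> 2 * pi * (local_limit_const / s)"
      by (simp add: A)
  qed
  have "(\<integral>t. transform_error t \<partial>lborel) = (\<integral>t. transform_error t + ?odd t \<partial>lborel)"
    using i1 odd_term[OF V] by simp
  then have norm_le2: "norm (\<integral>t. transform_error t \<partial>lborel) \<le> (\<integral>t. norm (transform_error t + ?odd t) \<partial>lborel)"
    using integral_norm_bound[of lborel "\<lambda>t. transform_error t + ?odd t"] by simp
  show "\<bar>sqrt (moment 2) * compound_density (moment 1) - std_normal_density 0\<bar>
      \<le> local_limit_const / moment 2 + R"
    unfolding s_def[symmetric]
  proof (rule final)
    show "s * norm (\<integral>t. iexp (- (t * (s * 0))) * transform_error t \<partial>lborel) \<le> (2 * A4 + A6) / moment 2 + 2 * pi * s * S"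
      using order_trans[OF mult_left_mono[OF norm_le2] i2] s1 by simp
    have "(2 * A4 + A6) / moment 2 \<le> 1 * (local_limit_const / moment 2)"
      using A V by (simp add: divide_right_mono)
    also have "\<dots> \<le> 2 * pi * (local_limit_const / moment 2)"
      using local_limit_const_nonneg V pi_gt3 by (intro mult_right_mono) auto
    finally show "(2 * A4 + A6) / moment 2 \<le> 2 * pi * (local_limit_const / moment 2)" .
  qed simp
qed

end

section \<open>Moments from a moment generating function\<close>

lemma exp_minus_linear_bound:
  fixes z :: real
  shows "\<bar>exp z - 1 - z\<bar> \<le> exp \<bar>z\<bar> * z\<^sup>2"
  using Taylor_exp_field[of z 1] by (simp add: power2_eq_square algebra_simps)

lemma difference_quotient_exp:
  fixes x :: real
  shows "(\<lambda>n. (exp (1 / real (Suc n) * x) - 1) / (1 / real (Suc n))) \<longlonglongrightarrow> x"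
proof (rule LIM_zero_cancel, rule Lim_null_comparison)
  let ?h = "\<lambda>n. 1 / real (Suc n)"
  have h: "?h \<longlonglongrightarrow> 0" by (rule LIMSEQ_Suc[OF lim_1_over_n])
  have "norm ((exp (?h n * x) - 1) / ?h n - x) \<le> exp \<bar>?h n * x\<bar> * x\<^sup>2 * ?h n" for n
  proof -
    have pos: "?h n > 0" by simp
    have "(exp (?h n * x) - 1) / ?h n - x = (exp (?h n * x) - 1 - ?h n * x) / ?h n"
    proof -
      have "?h n \<noteq> 0" by simp
      then show ?thesis by (simp only: diff_divide_distrib nonzero_mult_div_cancel_left not_False_eq_True)
    qed
    also have "\<bar>\<dots>\<bar> \<le> exp \<bar>?h n * x\<bar> * (?h n * x)\<^sup>2 / ?h n"
      using exp_minus_linear_bound[of "?h n * x"] pos unfolding abs_divide by (simp only: abs_of_pos divide_right_mono less_imp_le)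
    also have "\<dots> = exp \<bar>?h n * x\<bar> * x\<^sup>2 * ?h n"
      by (simp add: power2_eq_square)
    finally show ?thesis by simp
  qed
  then show "\<forall>\<^sub>F n in sequentially. norm ((exp (?h n * x) - 1) / ?h n - x) \<le> exp \<bar>?h n * x\<bar> * x\<^sup>2 * ?h n"
    by simp
  have "(\<lambda>n. exp \<bar>?h n * x\<bar> * x\<^sup>2 * ?h n) \<longlonglongrightarrow> exp \<bar>0 * x\<bar> * x\<^sup>2 * 0"
    by (intro tendsto_intros h)
  then show "(\<lambda>n. exp \<bar>?h n * x\<bar> * x\<^sup>2 * ?h n) \<longlonglongrightarrow> 0" by simp
qed

lemma second_difference_quotient_exp:
  fixes x :: real
  shows "(\<lambda>n. (exp (1 / real (Suc n) * x) - 1 - 1 / real (Suc n) * x) / (1 / real (Suc n))\<^sup>2) \<longlonglongrightarrow> x\<^sup>2 / 2"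
proof (rule LIM_zero_cancel, rule Lim_null_comparison)
  let ?h = "\<lambda>n. 1 / real (Suc n)"
  have h: "?h \<longlonglongrightarrow> 0" by (rule LIMSEQ_Suc[OF lim_1_over_n])
  have "norm ((exp (?h n * x) - 1 - ?h n * x) / (?h n)\<^sup>2 - x\<^sup>2 / 2) \<le> exp \<bar>?h n * x\<bar> * \<bar>x\<bar> ^ 3 / 2 * ?h n" for n
  proof -
    define a where "a = ?h n"
    have a: "a > 0" by (simp add: a_def)
    have "\<bar>exp (a * x) - 1 - a * x - (a * x)\<^sup>2 / 2\<bar> \<le> exp \<bar>a * x\<bar> * \<bar>a * x\<bar> ^ 3 / 2"
      using Taylor_exp_field[of "a * x" 2] by (simp add: eval_nat_numeral fact_numeral algebra_simps)
    then have "\<bar>exp (a * x) - 1 - a * x - (a * x)\<^sup>2 / 2\<bar> / a\<^sup>2 \<le> exp \<bar>a * x\<bar> * \<bar>a * x\<bar> ^ 3 / 2 / a\<^sup>2"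
      by (rule divide_right_mono) simp
    also have "exp \<bar>a * x\<bar> * \<bar>a * x\<bar> ^ 3 / 2 / a\<^sup>2 = exp \<bar>a * x\<bar> * \<bar>x\<bar> ^ 3 / 2 * a"
      using a by (simp add: abs_mult power_mult_distrib eval_nat_numeral)
    also have "\<bar>exp (a * x) - 1 - a * x - (a * x)\<^sup>2 / 2\<bar> / a\<^sup>2 = \<bar>(exp (a * x) - 1 - a * x) / a\<^sup>2 - x\<^sup>2 / 2\<bar>"
    proof -
      have "(exp (a * x) - 1 - a * x) / a\<^sup>2 - x\<^sup>2 / 2 = (exp (a * x) - 1 - a * x - (a * x)\<^sup>2 / 2) / a\<^sup>2"
        using a by (simp add: diff_divide_distrib power_mult_distrib)
      then show ?thesis using a by (simp only: abs_divide) simp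
    qed
    finally show ?thesis by (simp only: a_def real_norm_def)
  qed
  then show "\<forall>\<^sub>F n in sequentially. norm ((exp (?h n * x) - 1 - ?h n * x) / (?h n)\<^sup>2 - x\<^sup>2 / 2) \<le> exp \<bar>?h n * x\<bar> * \<bar>x\<bar> ^ 3 / 2 * ?h n"
    by simp
  have "(\<lambda>n. exp \<bar>?h n * x\<bar> * \<bar>x\<bar> ^ 3 / 2 * ?h n) \<longlonglongrightarrow> exp \<bar>0 * x\<bar> * \<bar>x\<bar> ^ 3 / 2 * 0"
    by (intro tendsto_intros h) simp
  then show "(\<lambda>n. exp \<bar>?h n * x\<bar> * \<bar>x\<bar> ^ 3 / 2 * ?h n) \<longlonglongrightarrow> 0" by simp
qed

text \<open>
  Dominating functions for the difference quotients, chosen so that finiteness of the moment generating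
  function at \<open>2\<close> and \<open>-2\<close> makes them integrable.
\<close>

lemma exp_quotient_bounds:
  fixes x a :: real
  assumes a: "0 < a" "a \<le> 1"
  shows "\<bar>(exp (a * x) - 1) / a\<bar> \<le> exp (2 * x) + exp (-2 * x)"
    and "\<bar>(exp (a * x) - 1 - a * x) / a\<^sup>2\<bar> \<le> 2 * (exp (2 * x) + exp (-2 * x))"
proof -
  have ax: "\<bar>a * x\<bar> \<le> \<bar>x\<bar>"
    using a by (simp add: abs_mult mult_left_le_one_le)
  have e2: "exp (2 * \<bar>x\<bar>) \<le> exp (2 * x) + exp (-2 * x)"
    by (cases "0 \<le> x") auto
  have x1: "\<bar>x\<bar> \<le> exp \<bar>x\<bar>"
    using exp_ge_add_one_self[of "\<bar>x\<bar>"] by linarith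
  have x2: "x\<^sup>2 \<le> 2 * exp \<bar>x\<bar>"
    using exp_lower_Taylor_quadratic[of "\<bar>x\<bar>"] by simp
  have ee: "exp \<bar>x\<bar> * exp \<bar>x\<bar> = exp (2 * \<bar>x\<bar>)"
    by (simp flip: exp_add)
  have "\<bar>exp (a * x) - 1\<bar> \<le> exp \<bar>a * x\<bar> * \<bar>a * x\<bar>"
    using Taylor_exp_field[of "a * x" 0] by simp
  also have "\<dots> \<le> exp \<bar>x\<bar> * (a * exp \<bar>x\<bar>)"
    using a ax x1 by (intro mult_mono) (auto simp: abs_mult)
  finally have "\<bar>exp (a * x) - 1\<bar> \<le> a * (exp \<bar>x\<bar> * exp \<bar>x\<bar>)"
    by (simp only: mult_ac)
  then have "\<bar>exp (a * x) - 1\<bar> \<le> a * exp (2 * \<bar>x\<bar>)"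
    unfolding ee .
  then have "\<bar>(exp (a * x) - 1) / a\<bar> \<le> exp (2 * \<bar>x\<bar>)"
    using a by (simp add: field_simps)
  then show "\<bar>(exp (a * x) - 1) / a\<bar> \<le> exp (2 * x) + exp (-2 * x)"
    using e2 by linarith
  have "\<bar>exp (a * x) - 1 - a * x\<bar> \<le> exp \<bar>a * x\<bar> * (a * x)\<^sup>2"
    by (rule exp_minus_linear_bound)
  also have "\<dots> \<le> exp \<bar>x\<bar> * (a\<^sup>2 * (2 * exp \<bar>x\<bar>))"
    using a ax x2 by (intro mult_mono) (auto simp: power_mult_distrib)
  finally have "\<bar>exp (a * x) - 1 - a * x\<bar> \<le> a\<^sup>2 * (2 * (exp \<bar>x\<bar> * exp \<bar>x\<bar>))"
    by (simp only: mult_ac)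
  then have "\<bar>exp (a * x) - 1 - a * x\<bar> \<le> a\<^sup>2 * (2 * exp (2 * \<bar>x\<bar>))"
    unfolding ee .
  then have "\<bar>(exp (a * x) - 1 - a * x) / a\<^sup>2\<bar> \<le> 2 * exp (2 * \<bar>x\<bar>)"
    using a by (simp add: field_simps)
  then show "\<bar>(exp (a * x) - 1 - a * x) / a\<^sup>2\<bar> \<le> 2 * (exp (2 * x) + exp (-2 * x))"
    by (rule order_trans) (use e2 in simp)
qed

text \<open>
  The mean and the variance are limits of difference quotients of the moment generating function at \<open>0\<close>,
  and dominated convergence exchanges these limits with the expectation. Centring by \<open>m\<close> first removes the
  linear term of \<open>K\<close>, so that the second quotient gives the variance directly.
\<close>

lemma (in prob_space) moments_from_mgf:
  fixes X :: "'a \<Rightarrow> real" and K :: "real \<Rightarrow> real"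
  assumes [measurable]: "X \<in> borel_measurable M"
    and mgf: "\<And>\<theta>. has_bochner_integral M (\<lambda>\<omega>. exp (\<theta> * X \<omega>)) (exp (K \<theta>))"
    and K: "\<And>\<theta>. \<bar>\<theta>\<bar> \<le> 1 \<Longrightarrow> \<bar>K \<theta> - \<theta> * m - \<theta>\<^sup>2 * v / 2\<bar> \<le> C * \<bar>\<theta>\<bar> ^ 3"
  shows "expectation X = m" and "variance X = v"
proof -
  define a where "a n = 1 / real (Suc n)" for n
  have a: "0 < a n" "a n \<le> 1" for n by (simp_all add: a_def)
  have a0: "a \<longlonglongrightarrow> 0" unfolding a_def[abs_def] by (rule LIMSEQ_Suc[OF lim_1_over_n])
  define r where "r \<theta> = K \<theta> - \<theta> * m" for \<theta>
  have r2: "(\<lambda>n. r (a n) / (a n)\<^sup>2) \<longlonglongrightarrow> v / 2"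
  proof (rule LIM_zero_cancel, rule Lim_null_comparison)
    have "norm (r (a n) / (a n)\<^sup>2 - v / 2) \<le> C * a n" for n
    proof -
      have "r (a n) / (a n)\<^sup>2 - v / 2 = (K (a n) - a n * m - (a n)\<^sup>2 * v / 2) / (a n)\<^sup>2"
        using a[of n] by (simp add: r_def field_simps)
      also have "\<bar>\<dots>\<bar> \<le> C * \<bar>a n\<bar> ^ 3 / (a n)\<^sup>2"
        unfolding abs_divide using K[of "a n"] a[of n] by (simp add: divide_right_mono)
      also have "\<dots> = C * a n"
        using a[of n] by (simp add: eval_nat_numeral)
      finally show ?thesis by simp
    qed
    then show "\<forall>\<^sub>F n in sequentially. norm (r (a n) / (a n)\<^sup>2 - v / 2) \<le> C * a n" by simp
    show "(\<lambda>n. C * a n) \<longlonglongrightarrow> 0" using tendsto_mult_right_zero[OF a0] .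
  qed
  have r1: "(\<lambda>n. r (a n) / a n) \<longlonglongrightarrow> 0"
  proof -
    have "(\<lambda>n. r (a n) / (a n)\<^sup>2 * a n) \<longlonglongrightarrow> v / 2 * 0" by (intro tendsto_mult r2 a0)
    moreover have "r (a n) / (a n)\<^sup>2 * a n = r (a n) / a n" for n
      using a[of n] by (simp add: power2_eq_square)
    ultimately show ?thesis by simp
  qed
  have r0: "(\<lambda>n. r (a n)) \<longlonglongrightarrow> 0"
  proof -
    have "(\<lambda>n. r (a n) / a n * a n) \<longlonglongrightarrow> 0 * 0" by (intro tendsto_mult r1 a0)
    moreover have "r (a n) / a n * a n = r (a n)" for n using a[of n] by simp
    ultimately show ?thesis by simp
  qed
  have Y: "has_bochner_integral M (\<lambda>\<omega>. exp (\<theta> * (X \<omega> - m))) (exp (r \<theta>))" for \<theta>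
  proof -
    have "has_bochner_integral M (\<lambda>\<omega>. exp (- (\<theta> * m)) * exp (\<theta> * X \<omega>)) (exp (- (\<theta> * m)) * exp (K \<theta>))"
      by (intro has_bochner_integral_mult_right mgf)
    then show ?thesis
      by (simp add: r_def algebra_simps flip: exp_add)
  qed
  let ?w = "\<lambda>\<omega>. exp (2 * (X \<omega> - m)) + exp (-2 * (X \<omega> - m))"
  have w: "integrable M ?w"
    using Y[of 2] Y[of "-2"] by (auto simp: has_bochner_integral_iff)
  have iY: "integrable M (\<lambda>\<omega>. exp (\<theta> * (X \<omega> - m)))" "expectation (\<lambda>\<omega>. exp (\<theta> * (X \<omega> - m))) = exp (r \<theta>)" for \<theta>
    using Y[of \<theta>] by (auto simp: has_bochner_integral_iff)
  have exp1: "\<bar>exp (r (a n)) - 1 - r (a n)\<bar> \<le> exp \<bar>r (a n)\<bar> * (r (a n))\<^sup>2" for n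
    by (rule exp_minus_linear_bound)
  have exp2: "(\<lambda>n. (exp (r (a n)) - 1) / (a n)\<^sup>2) \<longlonglongrightarrow> v / 2"
  proof -
    have "(\<lambda>n. (exp (r (a n)) - 1 - r (a n)) / (a n)\<^sup>2) \<longlonglongrightarrow> 0"
    proof (rule Lim_null_comparison)
      have "norm ((exp (r (a n)) - 1 - r (a n)) / (a n)\<^sup>2) \<le> exp \<bar>r (a n)\<bar> * (r (a n) / a n)\<^sup>2" for n
        using divide_right_mono[OF exp1[of n], of "(a n)\<^sup>2"] by (simp add: power_divide)
      then show "\<forall>\<^sub>F n in sequentially. norm ((exp (r (a n)) - 1 - r (a n)) / (a n)\<^sup>2) \<le> exp \<bar>r (a n)\<bar> * (r (a n) / a n)\<^sup>2"
        by simp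
      have "(\<lambda>n. exp \<bar>r (a n)\<bar> * (r (a n) / a n)\<^sup>2) \<longlonglongrightarrow> exp \<bar>0\<bar> * 0\<^sup>2"
        by (intro tendsto_intros r0 r1)
      then show "(\<lambda>n. exp \<bar>r (a n)\<bar> * (r (a n) / a n)\<^sup>2) \<longlonglongrightarrow> 0" by simp
    qed
    from tendsto_add[OF this r2] show ?thesis
      by (simp flip: add_divide_distrib)
  qed
  have "(\<lambda>n. expectation (\<lambda>\<omega>. (exp (a n * (X \<omega> - m)) - 1) / a n)) \<longlonglongrightarrow> expectation (\<lambda>\<omega>. X \<omega> - m)"
    and iX: "integrable M (\<lambda>\<omega>. X \<omega> - m)"
  proof -
    have 1: "AE \<omega> in M. (\<lambda>n. (exp (a n * (X \<omega> - m)) - 1) / a n) \<longlonglongrightarrow> X \<omega> - m"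
      unfolding a_def by (intro AE_I2 difference_quotient_exp)
    have 2: "AE \<omega> in M. norm ((exp (a n * (X \<omega> - m)) - 1) / a n) \<le> ?w \<omega>" for n
      unfolding real_norm_def by (intro AE_I2 exp_quotient_bounds(1)[OF a])
    show "(\<lambda>n. expectation (\<lambda>\<omega>. (exp (a n * (X \<omega> - m)) - 1) / a n)) \<longlonglongrightarrow> expectation (\<lambda>\<omega>. X \<omega> - m)"
      by (rule integral_dominated_convergence[OF _ _ w 1 2]) simp_all
    show "integrable M (\<lambda>\<omega>. X \<omega> - m)"
      by (rule integrable_dominated_convergence[OF _ _ w 1 2]) simp_all
  qed
  moreover have "expectation (\<lambda>\<omega>. (exp (a n * (X \<omega> - m)) - 1) / a n) = (exp (r (a n)) - 1) / (a n)\<^sup>2 * a n" for n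
    using iY[of "a n"] a[of n] by (simp add: prob_space power2_eq_square)
  moreover have "(\<lambda>n. (exp (r (a n)) - 1) / (a n)\<^sup>2 * a n) \<longlonglongrightarrow> v / 2 * 0"
    by (intro tendsto_mult exp2 a0)
  ultimately have "(\<lambda>n. (exp (r (a n)) - 1) / (a n)\<^sup>2 * a n) \<longlonglongrightarrow> expectation (\<lambda>\<omega>. X \<omega> - m)"
    and "(\<lambda>n. (exp (r (a n)) - 1) / (a n)\<^sup>2 * a n) \<longlonglongrightarrow> 0"
    by (simp_all only: mult_zero_right)
  then have EY: "expectation (\<lambda>\<omega>. X \<omega> - m) = 0"
    by (rule LIMSEQ_unique)
  have "integrable M (\<lambda>\<omega>. (X \<omega> - m) + m)"
    using iX by (intro Bochner_Integration.integrable_add) simp_all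
  then have "integrable M X" by simp
  then show EX: "expectation X = m"
    using EY by (simp add: prob_space)
  have "(\<lambda>n. expectation (\<lambda>\<omega>. (exp (a n * (X \<omega> - m)) - 1 - a n * (X \<omega> - m)) / (a n)\<^sup>2))
      \<longlonglongrightarrow> expectation (\<lambda>\<omega>. (X \<omega> - m)\<^sup>2 / 2)"
  proof (rule integral_dominated_convergence[where w="\<lambda>\<omega>. 2 * ?w \<omega>"])
    show "integrable M (\<lambda>\<omega>. 2 * ?w \<omega>)" by (rule integrable_mult_right[OF w])
    show "AE \<omega> in M. (\<lambda>n. (exp (a n * (X \<omega> - m)) - 1 - a n * (X \<omega> - m)) / (a n)\<^sup>2) \<longlonglongrightarrow> (X \<omega> - m)\<^sup>2 / 2"
      unfolding a_def by (intro AE_I2 second_difference_quotient_exp)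
    show "AE \<omega> in M. norm ((exp (a n * (X \<omega> - m)) - 1 - a n * (X \<omega> - m)) / (a n)\<^sup>2) \<le> 2 * ?w \<omega>" for n
      unfolding real_norm_def by (intro AE_I2 exp_quotient_bounds(2)[OF a])
  qed simp_all
  moreover have "expectation (\<lambda>\<omega>. (exp (a n * (X \<omega> - m)) - 1 - a n * (X \<omega> - m)) / (a n)\<^sup>2) = (exp (r (a n)) - 1) / (a n)\<^sup>2" for n
  proof -
    have "expectation (\<lambda>\<omega>. exp (a n * (X \<omega> - m)) - 1 - a n * (X \<omega> - m)) = exp (r (a n)) - 1 - a n * 0"
    proof -
      have "expectation (\<lambda>\<omega>. exp (a n * (X \<omega> - m)) - 1 - a n * (X \<omega> - m))
          = expectation (\<lambda>\<omega>. exp (a n * (X \<omega> - m)) - 1) - expectation (\<lambda>\<omega>. a n * (X \<omega> - m))"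
        by (intro Bochner_Integration.integral_diff Bochner_Integration.integrable_diff iY integrable_mult_right iX) simp
      also have "expectation (\<lambda>\<omega>. exp (a n * (X \<omega> - m)) - 1) = exp (r (a n)) - 1"
        using iY[of "a n"] by (simp add: prob_space)
      also have "expectation (\<lambda>\<omega>. a n * (X \<omega> - m)) = a n * 0"
        unfolding EY[symmetric] by (rule integral_mult_right_zero)
      finally show ?thesis .
    qed
    then show ?thesis by simp
  qed
  ultimately have "(\<lambda>n. (exp (r (a n)) - 1) / (a n)\<^sup>2) \<longlonglongrightarrow> expectation (\<lambda>\<omega>. (X \<omega> - m)\<^sup>2 / 2)"
    by (simp only:)
  then have "expectation (\<lambda>\<omega>. (X \<omega> - m)\<^sup>2 / 2) = v / 2"
    using exp2 by (rule LIMSEQ_unique)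
  then show "variance X = v"
    unfolding EX by simp
qed

context bounded_intensity
begin

text \<open>
  The expansion of the cumulant generating function in the form that \<open>moments_from_mgf\<close> asks for.
\<close>

lemma cumulant_taylor:
  assumes "\<bar>\<theta>\<bar> \<le> 1"
  shows "\<bar>(\<integral>x. (exp (\<theta> * x) - 1) * p x \<partial>lborel) - \<theta> * moment 1 - \<theta>\<^sup>2 * moment 2 / 2\<bar> \<le> exp 1 * moment 0 * \<bar>\<theta>\<bar> ^ 3"
proof -
  have i1: "integrable lborel (\<lambda>x. (exp (\<theta> * x) - 1) * p x)"
  proof -
    have "\<bar>exp (\<theta> * x) - 1\<bar> \<le> exp 1 + 1" if "x \<in> {0..1}" for x
    proof -
      have "\<theta> * x \<le> 1 * 1" using assms that by (intro mult_mono) auto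
      then show ?thesis using exp_le_cancel_iff[of "\<theta> * x" 1] exp_gt_zero[of "\<theta> * x"] by linarith
    qed
    then show ?thesis
      using integrable_bounded_mult[of "\<lambda>x. exp (\<theta> * x) - 1" "exp 1 + 1"] by simp
  qed
  note im = integrable_mult_right[OF integrable_moment]
  have "(\<integral>x. (exp (\<theta> * x) - 1) * p x \<partial>lborel) - \<theta> * moment 1 - \<theta>\<^sup>2 * moment 2 / 2
      = (\<integral>x. (exp (\<theta> * x) - 1) * p x - \<theta> * (x ^ 1 * p x) - \<theta>\<^sup>2 / 2 * (x ^ 2 * p x) \<partial>lborel)"
  proof -
    have "(\<integral>x. (exp (\<theta> * x) - 1) * p x - \<theta> * (x ^ 1 * p x) - \<theta>\<^sup>2 / 2 * (x ^ 2 * p x) \<partial>lborel)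
        = (\<integral>x. (exp (\<theta> * x) - 1) * p x - \<theta> * (x ^ 1 * p x) \<partial>lborel) - (\<integral>x. \<theta>\<^sup>2 / 2 * (x ^ 2 * p x) \<partial>lborel)"
      by (intro Bochner_Integration.integral_diff Bochner_Integration.integrable_diff i1 im)
    also have "(\<integral>x. (exp (\<theta> * x) - 1) * p x - \<theta> * (x ^ 1 * p x) \<partial>lborel)
        = (\<integral>x. (exp (\<theta> * x) - 1) * p x \<partial>lborel) - (\<integral>x. \<theta> * (x ^ 1 * p x) \<partial>lborel)"
      by (intro Bochner_Integration.integral_diff i1 im)
    finally show ?thesis
      unfolding moment_def by (simp only: integral_mult_right_zero)
  qed
  then have "\<bar>(\<integral>x. (exp (\<theta> * x) - 1) * p x \<partial>lborel) - \<theta> * moment 1 - \<theta>\<^sup>2 * moment 2 / 2\<bar>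
      = \<bar>\<integral>x. (exp (\<theta> * x) - 1) * p x - \<theta> * (x ^ 1 * p x) - \<theta>\<^sup>2 / 2 * (x ^ 2 * p x) \<partial>lborel\<bar>"
    by (rule arg_cong)
  also have "\<dots> \<le> (\<integral>x. exp 1 * \<bar>\<theta>\<bar> ^ 3 * (x ^ 0 * p x) \<partial>lborel)"
  proof (rule order_trans[OF integral_abs_bound], rule integral_mono')
    show "integrable lborel (\<lambda>x. exp 1 * \<bar>\<theta>\<bar> ^ 3 * (x ^ 0 * p x))" by (rule im)
    fix x
    show "\<bar>(exp (\<theta> * x) - 1) * p x - \<theta> * (x ^ 1 * p x) - \<theta>\<^sup>2 / 2 * (x ^ 2 * p x)\<bar> \<le> exp 1 * \<bar>\<theta>\<bar> ^ 3 * (x ^ 0 * p x)"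
    proof (cases "x \<in> {0..1}")
      case True
      have tx: "\<bar>\<theta> * x\<bar> \<le> \<bar>\<theta>\<bar>"
        using True by (simp add: abs_mult mult_left_le)
      have "(exp (\<theta> * x) - 1) * p x - \<theta> * (x ^ 1 * p x) - \<theta>\<^sup>2 / 2 * (x ^ 2 * p x)
          = (exp (\<theta> * x) - (\<Sum>i\<le>2. (\<theta> * x) ^ i / fact i)) * p x"
        by (simp add: eval_nat_numeral fact_numeral algebra_simps)
      also have "\<bar>\<dots>\<bar> = \<bar>exp (\<theta> * x) - (\<Sum>i\<le>2. (\<theta> * x) ^ i / fact i)\<bar> * p x"
        using p_nonneg by (simp add: abs_mult)
      also have "\<dots> \<le> (exp \<bar>\<theta> * x\<bar> * \<bar>\<theta> * x\<bar> ^ 3 / 2) * p x"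
        using Taylor_exp_field[of "\<theta> * x" 2] p_nonneg
        by (intro mult_right_mono) (auto simp: eval_nat_numeral fact_numeral)
      also have "\<dots> \<le> (exp 1 * \<bar>\<theta>\<bar> ^ 3 / 1) * p x"
        using tx assms p_nonneg by (intro mult_right_mono frac_le mult_mono power_mono) auto
      finally show ?thesis by simp
    qed (simp add: p_support)
  qed (simp add: p_nonneg)
  also have "\<dots> = exp 1 * moment 0 * \<bar>\<theta>\<bar> ^ 3"
    by (simp add: moment_def)
  finally show ?thesis .
qed

end

section \<open>The exponentially tilted intensity\<close>

text \<open>
  The double-angle formula gives \<open>\<bar>sin u\<bar> \<le> \<bar>u\<bar> * cos (u / 2)\<close> for \<open>\<bar>u\<bar> \<le> 2\<close>, with the cosine
  decreasing in \<open>\<bar>u\<bar>\<close>; for larger \<open>\<bar>u\<bar>\<close> the trivial bound \<open>1\<close> is at most \<open>\<bar>u\<bar> / 2\<close>.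
\<close>

lemma abs_sin_le_ratio:
  fixes u0 :: real
  assumes "0 < u0" "u0 \<le> 2"
  defines "\<eta> \<equiv> min (1 / 2) (1 - cos (u0 / 2))"
  shows "0 < \<eta>" and "\<And>u. u0 \<le> \<bar>u\<bar> \<Longrightarrow> \<bar>sin u\<bar> \<le> (1 - \<eta>) * \<bar>u\<bar>"
proof -
  have "cos (u0 / 2) < cos 0"
    using assms pi_gt3 by (intro cos_monotone_0_pi) auto
  then show "0 < \<eta>" by (simp add: \<eta>_def)
  fix u :: real
  assume u: "u0 \<le> \<bar>u\<bar>"
  show "\<bar>sin u\<bar> \<le> (1 - \<eta>) * \<bar>u\<bar>"
  proof (cases "\<bar>u\<bar> \<le> 2")
    case True
    define v where "v = \<bar>u\<bar> / 2"
    have v: "u0 / 2 \<le> v" "v \<le> 1" "0 < v" using u True assms(1) by (auto simp: v_def)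
    have "\<bar>sin u\<bar> = \<bar>sin (2 * v)\<bar>"
      by (cases "0 \<le> u") (auto simp: v_def)
    also have "\<dots> = 2 * \<bar>sin v\<bar> * \<bar>cos v\<bar>"
      by (simp add: sin_double abs_mult)
    also have "\<bar>cos v\<bar> = cos v"
      using v pi_gt3 by (simp add: cos_ge_zero)
    also have "2 * \<bar>sin v\<bar> * cos v \<le> 2 * v * cos (u0 / 2)"
      using v assms pi_gt3 abs_sin_x_le_abs_x[of v] by (intro mult_mono cos_monotone_0_pi_le cos_ge_zero) auto
    also have "\<dots> \<le> 2 * v * (1 - \<eta>)"
      using v by (intro mult_left_mono) (auto simp: \<eta>_def)
    finally show ?thesis by (simp add: v_def mult.commute)
  next
    case False
    have 1: "\<bar>sin u\<bar> \<le> 1 / 2 * \<bar>u\<bar>" using False abs_sin_le_one[of u] by linarith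
    have "\<eta> \<le> 1 / 2" unfolding \<eta>_def by (rule min.cobounded1)
    then have "1 / 2 * \<bar>u\<bar> \<le> (1 - \<eta>) * \<bar>u\<bar>" by (intro mult_right_mono) linarith+
    then show ?thesis using 1 by linarith
  qed
qed

lemma integral_cos_window:
  fixes e t :: real
  assumes e: "0 < e" and t: "t \<noteq> 0"
  shows "(\<lambda>x. cos (t * x)) integrable_on {1 - e..1}"
    and "\<bar>integral {1 - e..1} (\<lambda>x. cos (t * x))\<bar> \<le> 2 * \<bar>sin (t * e / 2)\<bar> / \<bar>t\<bar>"
proof -
  have "((\<lambda>x. cos (t * x)) has_integral (sin (t * 1) / t - sin (t * (1 - e)) / t)) {1 - e..1}"
    using e t by (intro fundamental_theorem_of_calculus)
      (auto intro!: derivative_eq_intros simp flip: has_real_derivative_iff_has_vector_derivative)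
  then have I: "integral {1 - e..1} (\<lambda>x. cos (t * x)) = (sin t - sin (t * (1 - e))) / t"
    and "(\<lambda>x. cos (t * x)) integrable_on {1 - e..1}"
    by (auto simp: diff_divide_distrib)
  then show "(\<lambda>x. cos (t * x)) integrable_on {1 - e..1}" by simp
  have "t - t * (1 - e) = t * e" by (simp add: algebra_simps)
  then have "sin t - sin (t * (1 - e)) = 2 * sin (t * e / 2) * cos ((t + t * (1 - e)) / 2)"
    by (simp only: sin_diff_sin)
  then have "\<bar>sin t - sin (t * (1 - e))\<bar> \<le> 2 * \<bar>sin (t * e / 2)\<bar> * 1"
    by (simp only: abs_mult) (intro mult_mono; simp)
  then show "\<bar>integral {1 - e..1} (\<lambda>x. cos (t * x))\<bar> \<le> 2 * \<bar>sin (t * e / 2)\<bar> / \<bar>t\<bar>"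
    unfolding I abs_divide by (intro divide_right_mono) auto
qed

context bounded_intensity
begin

lemma moment_0_le: "moment 0 \<le> B"
proof -
  have "moment 0 \<le> (\<integral>x. B * indicator {0..1::real} x \<partial>lborel)"
    unfolding moment_def
  proof (rule integral_mono[OF integrable_moment])
    show "x ^ 0 * p x \<le> B * indicator {0..1} x" for x
      using p_le p_support by (auto simp: indicator_def)
  qed (auto intro!: integrable_mult_right integrable_real_indicator)
  then show ?thesis by simp
qed

lemma integral_lower_window:
  fixes h :: "real \<Rightarrow> real"
  assumes e: "0 < e" "e \<le> 1" and low: "\<And>x. x \<in> {1 - e..1} \<Longrightarrow> c \<le> p x" and c: "0 \<le> c"
    and h: "continuous_on UNIV h" "\<And>x. x \<in> {0..1} \<Longrightarrow> 0 \<le> h x"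
  shows "c * integral {1 - e..1} h \<le> (\<integral>x. h x * p x \<partial>lborel)"
proof -
  have hc: "continuous_on S h" for S using h(1) continuous_on_subset by blast
  have hm: "h \<in> borel_measurable borel" using h(1) by (rule borel_measurable_continuous_onI)
  have "compact (h ` {0..1})" by (intro compact_continuous_image hc) simp
  then obtain K where K: "\<And>x. x \<in> {0..1} \<Longrightarrow> norm (h x) \<le> K"
    using compact_imp_bounded bounded_iff by (metis imageI)
  have si: "set_integrable lborel {1 - e..1} h"
    by (intro borel_integrable_atLeastAtMost') (rule hc)
  have "c * integral {1 - e..1} h = c * (LBINT x:{1 - e..1}. h x)"
    using set_borel_integral_eq_integral(2)[OF si] by simp
  also have "\<dots> = (\<integral>x. c * (indicator {1 - e..1} x * h x) \<partial>lborel)"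
    by (simp add: set_lebesgue_integral_def)
  also have "\<dots> \<le> (\<integral>x. h x * p x \<partial>lborel)"
  proof (rule integral_mono)
    show "integrable lborel (\<lambda>x. c * (indicator {1 - e..1} x * h x))"
      using si by (simp add: set_integrable_def)
    show "integrable lborel (\<lambda>x. h x * p x)"
      using integrable_bounded_mult[OF hm K] by simp
    fix x
    show "c * (indicator {1 - e..1} x * h x) \<le> h x * p x"
    proof (cases "x \<in> {1 - e..1}")
      case True
      then have "h x * c \<le> h x * p x" using e by (intro mult_left_mono low h(2)) auto
      then show ?thesis using True by (simp add: mult.commute)
    next
      case False
      then show ?thesis using h(2)[of x] p_nonneg[of x] p_support[of x]
        by (cases "x \<in> {0..1}") auto
    qed
  qed
  finally show ?thesis .
qed

lemma Re_fourier: "Re (fourier p t) = (\<integral>x. cos (t * x) * p x \<partial>lborel)"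
proof -
  have "integrable lborel (\<lambda>x. iexp (t * x) * complex_of_real (p x))"
    by (rule integrable_bounded_mult[where K=1]) simp_all
  then show ?thesis
    unfolding fourier_def by (subst integral_Re[symmetric]) (simp_all add: Re_exp)
qed

text \<open>
  The numbers \<open>m 0 + Re (\<psi> t)\<close> and \<open>m 0 - Re (\<psi> t)\<close> are integrals of \<open>1 + cos (t * x)\<close> and \<open>1 - cos (t * x)\<close>
  against the intensity. Over the window of length \<open>e\<close> on which the intensity is at least \<open>c\<close>, the mean of
  the cosine stays away from \<open>1\<close> and \<open>-1\<close> uniformly in \<open>\<bar>t\<bar> > 1\<close>.
\<close>

lemma spectral_gap:
  assumes e: "0 < e" "e \<le> 1" and low: "\<And>x. x \<in> {1 - e..1} \<Longrightarrow> c \<le> p x" and c: "0 \<le> c"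
    and t: "1 < \<bar>t\<bar>"
  shows "\<bar>Re (fourier p t)\<bar> \<le> moment 0 - c * (e * min (1 / 2) (1 - cos (e / 4)))"
proof -
  define \<eta> where "\<eta> = min (1 / 2) (1 - cos (e / 4))"
  have sinle: "\<bar>sin u\<bar> \<le> (1 - \<eta>) * \<bar>u\<bar>" if "e / 2 \<le> \<bar>u\<bar>" for u
    using abs_sin_le_ratio(2)[of "e / 2" u] e that by (simp add: \<eta>_def)
  have t0: "t \<noteq> 0" using t by auto
  have "e / 2 \<le> \<bar>t * e / 2\<bar>"
    using e t by (simp add: abs_mult)
  from sinle[OF this] have "2 * \<bar>sin (t * e / 2)\<bar> / \<bar>t\<bar> \<le> 2 * ((1 - \<eta>) * \<bar>t * e / 2\<bar>) / \<bar>t\<bar>"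
    by (intro divide_right_mono mult_left_mono) auto
  also have "\<dots> = (1 - \<eta>) * e"
    using e t0 by (simp add: abs_mult)
  finally have Icos: "\<bar>integral {1 - e..1} (\<lambda>x. cos (t * x))\<bar> \<le> (1 - \<eta>) * e"
    using integral_cos_window(2)[OF e(1) t0] by linarith
  have icos: "integrable lborel (\<lambda>x. cos (t * x) * p x)"
    using integrable_bounded_mult[of "\<lambda>x. cos (t * x)" 1] by simp
  have main: "c * (e * \<eta>) \<le> moment 0 + r * Re (fourier p t)" if r: "r = 1 \<or> r = -1" for r
  proof -
    have "c * integral {1 - e..1} (\<lambda>x. 1 + r * cos (t * x)) \<le> (\<integral>x. (1 + r * cos (t * x)) * p x \<partial>lborel)"
    proof (rule integral_lower_window[OF e low c])
      show "continuous_on UNIV (\<lambda>x. 1 + r * cos (t * x))" by (intro continuous_intros)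
      fix x :: real
      show "0 \<le> 1 + r * cos (t * x)"
        using r
      proof (elim disjE)
        assume r1: "r = 1"
        show ?thesis unfolding r1 using cos_ge_minus_one[of "t * x"] by linarith
      next
        assume r1: "r = -1"
        show ?thesis unfolding r1 using cos_le_one[of "t * x"] by linarith
      qed
    qed
    also have "integral {1 - e..1} (\<lambda>x. 1 + r * cos (t * x)) = e + r * integral {1 - e..1} (\<lambda>x. cos (t * x))"
      using e integral_cos_window(1)[OF e(1) t0]
      by (subst Henstock_Kurzweil_Integration.integral_add) (auto intro!: integrable_on_mult_right)
    also have "(\<integral>x. (1 + r * cos (t * x)) * p x \<partial>lborel) = moment 0 + r * Re (fourier p t)"
    proof -
      have "(\<integral>x. (1 + r * cos (t * x)) * p x \<partial>lborel) = (\<integral>x. p x + r * (cos (t * x) * p x) \<partial>lborel)"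
        by (simp add: algebra_simps)
      also have "\<dots> = (\<integral>x. p x \<partial>lborel) + (\<integral>x. r * (cos (t * x) * p x) \<partial>lborel)"
        by (intro Bochner_Integration.integral_add integrable_p integrable_mult_right icos)
      finally show ?thesis by (simp add: moment_def Re_fourier)
    qed
    finally have 1: "c * (e + r * integral {1 - e..1} (\<lambda>x. cos (t * x))) \<le> moment 0 + r * Re (fourier p t)" .
    have "e * \<eta> \<le> e + r * integral {1 - e..1} (\<lambda>x. cos (t * x))"
      using r Icos by (elim disjE) (auto simp: algebra_simps abs_le_iff)
    then have "c * (e * \<eta>) \<le> c * (e + r * integral {1 - e..1} (\<lambda>x. cos (t * x)))"
      using c by (rule mult_left_mono)
    with 1 show ?thesis by linarith
  qed
  show ?thesis
    using main[of 1] main[of "-1"] unfolding \<eta>_def by (auto simp: abs_le_iff)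
qed

lemma moment_2_lower:
  assumes e: "0 < e" "e \<le> 1 / 2" and low: "\<And>x. x \<in> {1 - e..1} \<Longrightarrow> c \<le> p x" and c: "0 \<le> c"
  shows "c * e / 4 \<le> moment 2"
proof -
  have "c * integral {1 - e..1} (\<lambda>x. 1 / 4) \<le> c * integral {1 - e..1} (\<lambda>x. x ^ 2)"
  proof (intro mult_left_mono c integral_le)
    fix x assume "x \<in> {1 - e..1}"
    then have "1 / 2 \<le> x" using e by auto
    then have "(1 / 2)\<^sup>2 \<le> x ^ 2" by (intro power_mono) auto
    then show "1 / 4 \<le> x ^ 2" by (simp add: power2_eq_square)
  qed (auto intro!: integrable_continuous_real continuous_intros)
  also have "\<dots> \<le> moment 2"
    unfolding moment_def using e by (intro integral_lower_window low c) (auto intro!: continuous_intros)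
  finally show ?thesis using e by simp
qed

text \<open>
  Above \<open>1 / 2\<close> the first moment is paid for by twice the second; below, by the supremum \<open>b\<close> of the intensity.
\<close>

lemma moment_1_le:
  assumes "\<And>x. x \<in> {0..1 / 2} \<Longrightarrow> p x \<le> b"
  shows "moment 1 \<le> 2 * moment 2 + b"
proof -
  have b0: "0 \<le> b" using assms[of 0] p_nonneg[of 0] by simp
  have "moment 1 \<le> (\<integral>x. 2 * (x ^ 2 * p x) + b * indicator {0..1::real} x \<partial>lborel)"
    unfolding moment_def
  proof (rule integral_mono[OF integrable_moment])
    show "integrable lborel (\<lambda>x. 2 * (x ^ 2 * p x) + b * indicator {0..1::real} x)"
      by (intro Bochner_Integration.integrable_add integrable_mult_right integrable_moment integrable_real_indicator) auto
    fix x :: real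
    consider "x \<in> {0..1 / 2}" | "x \<in> {1 / 2<..1}" | "x \<notin> {0..1}" by force
    then show "x ^ 1 * p x \<le> 2 * (x ^ 2 * p x) + b * indicator {0..1} x"
    proof cases
      case 1
      have "x ^ 1 * p x \<le> 1 * b" using 1 assms p_nonneg by (intro mult_mono) auto
      moreover have "0 \<le> x ^ 2 * p x" using p_nonneg[of x] by simp
      moreover have "indicator {0..1} x = (1::real)" using 1 by simp
      ultimately show ?thesis by (simp only: mult_1_left mult_1_right)
    next
      case 2
      have "x \<le> 2 * x ^ 2" using 2 by (simp add: power2_eq_square)
      then have "x * p x \<le> 2 * x ^ 2 * p x" using p_nonneg by (rule mult_right_mono)
      then show ?thesis using b0 by (simp add: indicator_def mult.assoc)
    qed (simp add: p_support)
  qed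
  also have "\<dots> = 2 * moment 2 + b"
    unfolding moment_def
    by (subst Bochner_Integration.integral_add)
      (auto intro!: integrable_mult_right integrable_moment integrable_real_indicator)
  finally show ?thesis .
qed

end

text \<open>
  On each open piece the function extends continuously to the closed piece by its one-sided limits, hence is
  bounded there; the finitely many endpoints contribute finitely many further values.
\<close>

lemma piecewise_Ck_unit_regular:
  assumes "piecewise_Ck_unit k g"
  obtains D G where "finite D" and "{0, 1} \<subseteq> D"
    and "\<And>x. x \<in> {0..1} \<Longrightarrow> \<bar>g x\<bar> \<le> G"
    and "\<And>x. x \<in> {0..1} \<Longrightarrow> x \<notin> D \<Longrightarrow> isCont g x"
proof -
  from assms obtain n t where t0: "t 0 = 0" and tn: "t n = (1::real)"
    and t: "\<And>i. i < n \<Longrightarrow> t i < t (Suc i)" "\<And>i. i < n \<Longrightarrow> Ck_on k g {t i<..<t (Suc i)}"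
    and lim: "\<And>i. i < n \<Longrightarrow> (\<exists>l. (g \<longlongrightarrow> l) (at_right (t i))) \<and> (\<exists>l. (g \<longlongrightarrow> l) (at_left (t (Suc i))))"
    unfolding piecewise_Ck_unit_def by (metis funpow_0 le0)
  define D where "D = t ` {..n}"
  have cont: "continuous_on {t i<..<t (Suc i)} g" if "i < n" for i
  proof -
    have "\<forall>j\<le>k. continuous_on {t i<..<t (Suc i)} ((deriv ^^ j) g)"
      using t(2)[OF that] unfolding Ck_on_def by blast
    from this[rule_format, of 0] show ?thesis by simp
  qed
  have cover: "x \<in> D \<or> (\<exists>i<m. x \<in> {t i<..<t (Suc i)})" if "m \<le> n" "0 \<le> x" "x \<le> t m" for m x
    using that
  proof (induction m)
    case 0
    then show ?case using t0 by (force simp: D_def)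
  next
    case (Suc m)
    show ?case
    proof (cases "x \<le> t m")
      case True
      then show ?thesis using Suc by (auto intro: less_SucI)
    next
      case False
      then show ?thesis using Suc.prems by (cases "x = t (Suc m)") (auto simp: D_def)
    qed
  qed
  have bnd: "bounded (g ` {t i<..<t (Suc i)})" if i: "i < n" for i
  proof -
    obtain l r where l: "(g \<longlongrightarrow> l) (at_right (t i))" and r: "(g \<longlongrightarrow> r) (at_left (t (Suc i)))"
      using lim[OF i] by blast
    define h where "h x = (if x = t i then l else if x = t (Suc i) then r else g x)" for x
    have "continuous_on {t i..t (Suc i)} h"
    proof (rule continuous_on_IccI)
      show "(h \<longlongrightarrow> h (t i)) (at_right (t i))"
      proof -
        have "\<forall>\<^sub>F x in at_right (t i). h x = g x"
          using t(1)[OF i] by (auto simp: eventually_at_right_field h_def intro!: exI[of _ "t (Suc i)"])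
        then show ?thesis using l by (simp add: h_def tendsto_cong)
      qed
      show "(h \<longlongrightarrow> h (t (Suc i))) (at_left (t (Suc i)))"
      proof -
        have "\<forall>\<^sub>F x in at_left (t (Suc i)). h x = g x"
          using t(1)[OF i] by (auto simp: eventually_at_left_field h_def intro!: exI[of _ "t i"])
        then show ?thesis using r t(1)[OF i] by (simp add: h_def tendsto_cong)
      qed
      fix x assume x: "t i < x" "x < t (Suc i)"
      have "g \<midarrow>x\<rightarrow> g x"
        using cont[OF i] x by (simp add: continuous_on_eq_continuous_at isCont_def)
      moreover have "\<forall>\<^sub>F y in at x. h y = g y"
      proof -
        have "\<forall>\<^sub>F y in nhds x. y \<in> {t i<..<t (Suc i)}"
          using x by (intro eventually_nhds_in_open) auto
        then have "\<forall>\<^sub>F y in at x. y \<in> {t i<..<t (Suc i)}"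
          by (simp add: eventually_nhds_conv_at)
        then show ?thesis by eventually_elim (auto simp: h_def)
      qed
      ultimately show "h \<midarrow>x\<rightarrow> h x"
        using x by (simp add: h_def tendsto_cong)
    qed (rule t(1)[OF i])
    then have "bounded (h ` {t i..t (Suc i)})"
      by (intro compact_imp_bounded compact_continuous_image) auto
    moreover have "g ` {t i<..<t (Suc i)} \<subseteq> h ` {t i..t (Suc i)}"
    proof
      fix y assume "y \<in> g ` {t i<..<t (Suc i)}"
      then obtain x where "x \<in> {t i<..<t (Suc i)}" "y = g x" by blast
      then show "y \<in> h ` {t i..t (Suc i)}" by (auto simp: h_def intro!: image_eqI[of _ _ x])
    qed
    ultimately show ?thesis using bounded_subset by blast
  qed
  have "g ` {0..1} \<subseteq> g ` D \<union> (\<Union>i\<in>{..<n}. g ` {t i<..<t (Suc i)})"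
  proof
    fix y assume "y \<in> g ` {0..1}"
    then obtain x where x: "0 \<le> x" "x \<le> 1" "y = g x" by auto
    with cover[of n x] tn show "y \<in> g ` D \<union> (\<Union>i\<in>{..<n}. g ` {t i<..<t (Suc i)})" by force
  qed
  moreover have "bounded (g ` D \<union> (\<Union>i\<in>{..<n}. g ` {t i<..<t (Suc i)}))"
    unfolding bounded_Un by (intro conjI finite_imp_bounded bounded_UN ballI bnd) (auto simp: D_def)
  ultimately have "bounded (g ` {0..1})" using bounded_subset by blast
  then obtain G where "\<forall>y\<in>g ` {0..1}. norm y \<le> G"
    unfolding bounded_iff by blast
  then have G: "\<bar>g x\<bar> \<le> G" if "x \<in> {0..1}" for x
    using that by simp
  show ?thesis
  proof (rule that[of D G])
    show "finite D" by (simp add: D_def)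
    have "t 0 \<in> D" "t n \<in> D" by (auto simp: D_def)
    then show "{0, 1} \<subseteq> D" by (simp add: t0 tn)
    show "\<bar>g x\<bar> \<le> G" if "x \<in> {0..1}" for x by (rule G[OF that])
    fix x assume x: "x \<in> {0..1::real}" "x \<notin> D"
    then obtain i where "i < n" "x \<in> {t i<..<t (Suc i)}"
      using cover[of n x] tn by auto
    then show "isCont g x"
      using cont[of i] by (simp add: continuous_on_eq_continuous_at)
  qed
qed

definition tilted :: "(real \<Rightarrow> real) \<Rightarrow> real \<Rightarrow> real \<Rightarrow> real"
  where "tilted g \<beta> x = (if x \<in> {0..1} then exp (\<beta> * x) * g x else 0)"

lemma bounded_intensity_tilted:
  assumes nonneg: "\<And>x. x \<in> {0..1} \<Longrightarrow> 0 \<le> g x"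
    and D: "finite D" "{0, 1} \<subseteq> D" "\<And>x. x \<in> {0..1} \<Longrightarrow> x \<notin> D \<Longrightarrow> isCont g x"
    and G: "\<And>x. x \<in> {0..1} \<Longrightarrow> g x \<le> G" and \<beta>: "0 \<le> \<beta>"
  shows "bounded_intensity (tilted g \<beta>) (G * exp \<beta>)"
proof
  have cont: "isCont (tilted g \<beta>) x" if "x \<notin> D" for x
  proof (cases "x \<in> {0..1}")
    case True
    have "x \<noteq> 0" "x \<noteq> 1" using that D(2) by auto
    then have "x \<in> {0<..<1}" using True by auto
    then have "\<forall>\<^sub>F y in nhds x. y \<in> {0<..<1}"
      by (intro eventually_nhds_in_open) auto
    then have "\<forall>\<^sub>F y in nhds x. tilted g \<beta> y = exp (\<beta> * y) * g y"
      by eventually_elim (simp add: tilted_def)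
    moreover have "isCont (\<lambda>y. exp (\<beta> * y) * g y) x"
      using D(3)[OF True that] by (intro continuous_intros)
    ultimately show ?thesis by (simp add: isCont_cong)
  next
    case False
    then have "\<forall>\<^sub>F y in nhds x. y \<in> - {0..1}"
      by (intro eventually_nhds_in_open) auto
    then have "\<forall>\<^sub>F y in nhds x. tilted g \<beta> y = 0"
      by eventually_elim (auto simp: tilted_def)
    then show ?thesis by (simp add: isCont_cong)
  qed
  show "tilted g \<beta> \<in> borel_measurable borel"
    by (rule borel_measurable_continuous_countable_exceptions[of D])
      (use D(1) cont in \<open>auto intro: countable_finite continuous_at_imp_continuous_on\<close>)
  show "AE x in lborel. isCont (tilted g \<beta>) x"
  proof (rule AE_I'[OF finite_imp_null_set_lborel[OF D(1)]])
    show "{x \<in> space lborel. \<not> isCont (tilted g \<beta>) x} \<subseteq> D" using cont by auto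
  qed
  fix x
  show "0 \<le> tilted g \<beta> x" using nonneg by (simp add: tilted_def)
  show "x \<notin> {0..1} \<Longrightarrow> tilted g \<beta> x = 0" unfolding tilted_def by (rule if_not_P)
  have G0: "0 \<le> G" using nonneg[of 0] G[of 0] by simp
  show "tilted g \<beta> x \<le> G * exp \<beta>"
  proof (cases "x \<in> {0..1}")
    case True
    have "g x * exp (\<beta> * x) \<le> G * exp \<beta>"
      using True \<beta> G0 by (intro mult_mono G) (auto simp: mult_left_le)
    then show ?thesis using True by (simp add: tilted_def mult.commute)
  qed (use G0 in \<open>auto simp: tilted_def\<close>)
qed

lemma tilted_set_integral:
  "(LBINT x:{0..1}. h x * exp (\<beta> * x) * g x) = (\<integral>x. h x * tilted g \<beta> x \<partial>lborel)"
  unfolding set_lebesgue_integral_def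
  by (intro Bochner_Integration.integral_cong) (auto simp: tilted_def)

lemma total_intensity_eq_moment:
  assumes "bounded_intensity (tilted g \<beta>) B"
  shows "total_intensity g \<beta> = bounded_intensity.moment (tilted g \<beta>) 0"
  unfolding total_intensity_def bounded_intensity.moment_def[OF assms]
  using tilted_set_integral[of "\<lambda>_. 1"] by simp

lemma defective_density_eq_compound_density:
  assumes "bounded_intensity (tilted g \<beta>) B"
  shows "defective_density g \<beta> = bounded_intensity.compound_density (tilted g \<beta>)"
proof -
  have "jump_density g \<beta> = (\<lambda>x. tilted g \<beta> x / bounded_intensity.moment (tilted g \<beta>) 0)"
    unfolding jump_density_def total_intensity_eq_moment[OF assms] tilted_def by (auto simp: fun_eq_iff)
  then show ?thesis
    by (intro ext) (simp only: defective_density_def bounded_intensity.compound_density_def[OF assms]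
      total_intensity_eq_moment[OF assms])
qed

text \<open>
  The mean and the variance are the first two moments of the intensity, so the standardisation can be
  expressed through the intensity alone, whatever the underlying probability space.
\<close>

lemma standardized_density_eq_compound_density:
  assumes I: "bounded_intensity (tilted g \<beta>) B"
    and "prob_space M" and "X \<in> borel_measurable M"
    and mgf: "\<And>\<theta>. has_bochner_integral M (\<lambda>\<omega>. exp (\<theta> * X \<omega>))
      (exp (LBINT x:{0..1}. (exp (\<theta> * x) - 1) * exp (\<beta> * x) * g x))"
  defines "m \<equiv> bounded_intensity.moment (tilted g \<beta>)"
  shows "prob_space.expectation M X = m 1"
    and "standardized_defective_density g \<beta> M X y
      = sqrt (m 2) * bounded_intensity.compound_density (tilted g \<beta>) (sqrt (m 2) * y + m 1)"
proof -
  interpret I: bounded_intensity "tilted g \<beta>" B by (rule I)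
  interpret prob_space M by fact
  note moments = moments_from_mgf[OF assms(3) mgf[unfolded tilted_set_integral] I.cumulant_taylor]
  from moments(1) show 1: "expectation X = m 1" by (simp add: m_def)
  from moments(2) have 2: "variance X = m 2" by (simp add: m_def)
  show "standardized_defective_density g \<beta> M X y
      = sqrt (m 2) * I.compound_density (sqrt (m 2) * y + m 1)"
    unfolding standardized_defective_density_def defective_density_eq_compound_density[OF I] Let_def 1[symmetric] 2[symmetric] ..
qed

context bounded_intensity
begin

text \<open>
  With \<open>\<kappa>\<close> and \<open>m 0\<close> both at least \<open>d\<close>, every factor of the remainder other than the exponentials is at
  most a constant times a power of \<open>B\<close>, which bounds the total mass and with it the variance.
\<close>

lemma local_limit_error_le:
  assumes V: "1 \<le> moment 2"
    and gap: "\<And>t. 1 < \<bar>t\<bar> \<Longrightarrow> \<bar>Re (fourier p t)\<bar> \<le> moment 0 - \<kappa>"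
    and d: "d \<le> \<kappa>" "d \<le> moment 0" and small: "4 * B ^ 4 * exp (- d) \<le> 1"
  shows "sqrt (moment 2) * (exp (- moment 0) * (B + 1 + moment 0) + exp (- \<kappa>) * B * moment 0) \<le> 1 / moment 1"
proof -
  have m: "moment 2 \<le> moment 1" "moment 1 \<le> moment 0" "moment 0 \<le> B"
    using moment_antimono[of 1 2] moment_antimono[of 0 1] moment_0_le by auto
  have B1: "1 \<le> B" using m V by linarith
  have "sqrt (moment 2) \<le> sqrt (B\<^sup>2)"
    using m V B1 power_increasing[of 1 2 B] by (intro real_sqrt_le_mono) simp
  then have s: "sqrt (moment 2) \<le> B" using B1 by simp
  have "exp (- moment 0) * (B + 1 + moment 0) + exp (- \<kappa>) * B * moment 0
      \<le> exp (- d) * (3 * B\<^sup>2) + exp (- d) * B * B"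
    using m d B1 V power_increasing[of 1 2 B] by (intro add_mono mult_mono) auto
  then have "sqrt (moment 2) * (exp (- moment 0) * (B + 1 + moment 0) + exp (- \<kappa>) * B * moment 0)
      \<le> B * (exp (- d) * (3 * B\<^sup>2) + exp (- d) * B * B)"
    using s B1 m V by (intro mult_mono) auto
  also have "\<dots> = 4 * B ^ 4 * exp (- d) / B"
    using B1 by (simp add: eval_nat_numeral field_simps)
  also have "\<dots> \<le> 1 / moment 1"
    using small m V B1 by (intro frac_le) auto
  finally show ?thesis .
qed

end

lemma filterlim_exp_half_at_top:
  fixes c :: real
  assumes "0 < c"
  shows "filterlim (\<lambda>\<beta>. c * exp (\<beta> / 2)) at_top at_top"
proof (rule filterlim_tendsto_pos_mult_at_top[OF tendsto_const assms], rule filterlim_compose[OF exp_at_top])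
  show "filterlim (\<lambda>\<beta>::real. \<beta> / 2) at_top at_top"
    using filterlim_tendsto_pos_mult_at_top[OF tendsto_const _ filterlim_ident, of "1 / 2 :: real"] by simp
qed

lemma polynomial_times_double_exp_decay:
  fixes d K :: real
  assumes "0 < d"
  shows "((\<lambda>\<beta>. K * exp (\<beta> / 2) ^ n * exp (- (d * exp (\<beta> / 2)))) \<longlongrightarrow> 0) at_top"
proof -
  note u = filterlim_exp_half_at_top[OF assms]
  have "((\<lambda>\<beta>. K / d ^ n * ((d * exp (\<beta> / 2)) ^ n / exp (d * exp (\<beta> / 2)))) \<longlongrightarrow> K / d ^ n * 0) at_top"
    by (intro tendsto_mult tendsto_const filterlim_compose[OF tendsto_power_div_exp_0 u])
  moreover have "K / d ^ n * ((d * exp (\<beta> / 2)) ^ n / exp (d * exp (\<beta> / 2))) = K * exp (\<beta> / 2) ^ n * exp (- (d * exp (\<beta> / 2)))" for \<beta>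
    using assms by (simp add: power_mult_distrib exp_minus field_simps)
  ultimately show ?thesis by simp
qed

theorem proposition1:
  fixes g :: "real \<Rightarrow> real" and \<epsilon> :: real
    and M :: "real \<Rightarrow> 'a measure" and T :: "real \<Rightarrow> 'a \<Rightarrow> real"
  assumes g_nonneg: "\<And>x. x \<in> {0..1} \<Longrightarrow> 0 \<le> g x"
    and g_piecewise: "piecewise_Ck_unit 2 g"
    and eps_pos: "0 < \<epsilon>"
    and g_lower: "\<And>x. x \<in> {0..1} \<Longrightarrow> x \<in> {1 - \<epsilon>..1} \<Longrightarrow> \<epsilon> \<le> g x"
    and prob: "\<And>\<beta>. prob_space (M \<beta>)"
    and T_measurable: "\<And>\<beta>. T \<beta> \<in> borel_measurable (M \<beta>)"
    and T_nonneg: "\<And>\<beta>. AE \<omega> in M \<beta>. 0 \<le> T \<beta> \<omega>"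
    and T_mgf: "\<And>\<beta> \<theta>. has_bochner_integral (M \<beta>) (\<lambda>\<omega>. exp (\<theta> * T \<beta> \<omega>))
      (exp (LBINT x:{0..1}. (exp (\<theta> * x) - 1) * exp (\<beta> * x) * g x))"
  shows "filterlim (\<lambda>\<beta>. prob_space.expectation (M \<beta>) (T \<beta>)) at_top at_top \<and>
    (\<exists>C. \<forall>\<^sub>F \<beta> in at_top. \<forall>y.
      \<bar>standardized_defective_density g \<beta> (M \<beta>) (T \<beta>) y - 1 / sqrt (2 * pi) * exp (- y\<^sup>2 / 2)\<bar>
        \<le> C * (1 / sqrt (prob_space.expectation (M \<beta>) (T \<beta>)))) \<and>
    (\<lambda>\<beta>. standardized_defective_density g \<beta> (M \<beta>) (T \<beta>) 0 - 1 / sqrt (2 * pi))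
      \<in> O[at_top](\<lambda>\<beta>. 1 / prob_space.expectation (M \<beta>) (T \<beta>))"
proof -
  obtain D G0 where D: "finite D" "{0, 1} \<subseteq> D" "\<And>x. x \<in> {0..1} \<Longrightarrow> x \<notin> D \<Longrightarrow> isCont g x"
    and G0: "\<And>x. x \<in> {0..1} \<Longrightarrow> \<bar>g x\<bar> \<le> G0"
    using piecewise_Ck_unit_regular[OF g_piecewise] by metis
  define G where "G = max 1 G0"
  have G: "g x \<le> G" if "x \<in> {0..1}" for x
    using G0[OF that] by (simp add: G_def)
  have G1: "1 \<le> G" by (simp add: G_def)
  \<comment> \<open>At most \<open>1 / 2\<close>, so that \<open>exp (\<beta> * x) \<ge> exp (\<beta> / 2)\<close> on the window where \<open>g\<close> is bounded below.\<close>
  define e where "e = min \<epsilon> (1 / 2)"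
  have e: "0 < e" "e \<le> 1 / 2" "e \<le> \<epsilon>" using eps_pos by (simp_all add: e_def)
  define \<eta> where "\<eta> = min (1 / 2) (1 - cos (e / 4))"
  have \<eta>: "0 < \<eta>" using abs_sin_le_ratio(1)[of "e / 2"] e by (simp add: \<eta>_def)
  \<comment> \<open>The rates of the lower bounds on the variance and on the spectral gap, both in units of \<open>exp (\<beta> / 2)\<close>.\<close>
  define d where "d = min (e\<^sup>2 / 4) (e\<^sup>2 * \<eta>)"
  have d0: "0 < d" using e \<eta> by (simp add: d_def)
  \<comment> \<open>The ratio in the comparison of the mean with the variance.\<close>
  define A where "A = 2 + 4 * G / e\<^sup>2"
  have A1: "1 \<le> A" using G1 by (simp add: A_def)
  define E where "E \<beta> = prob_space.expectation (M \<beta>) (T \<beta>)" for \<beta>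
  define m where "m \<beta> = bounded_intensity.moment (tilted g \<beta>)" for \<beta>
  let ?K = local_limit_const
  have I: "bounded_intensity (tilted g \<beta>) (G * exp \<beta>)" if "0 \<le> \<beta>" for \<beta>
    by (rule bounded_intensity_tilted[OF g_nonneg D G that])
  have low: "e * exp (\<beta> / 2) \<le> tilted g \<beta> x" if "0 \<le> \<beta>" "x \<in> {1 - e..1}" for \<beta> x
  proof -
    have x: "x \<in> {0..1}" "1 / 2 \<le> x" "x \<in> {1 - \<epsilon>..1}" using that e by auto
    have "\<beta> * (1 / 2) \<le> \<beta> * x" using that x by (intro mult_left_mono)
    then have "exp (\<beta> / 2) * e \<le> exp (\<beta> * x) * g x"
      using g_lower[OF x(1,3)] e by (intro mult_mono) auto
    then show ?thesis using x by (simp add: tilted_def mult.commute)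
  qed
  have E_eq: "E \<beta> = m \<beta> 1" if "0 \<le> \<beta>" for \<beta>
    unfolding E_def m_def by (rule standardized_density_eq_compound_density(1)[OF I[OF that] prob T_measurable T_mgf])
  have V_lower: "e\<^sup>2 / 4 * exp (\<beta> / 2) \<le> m \<beta> 2" if "0 \<le> \<beta>" for \<beta>
    using bounded_intensity.moment_2_lower[OF I[OF that] e(1,2) low[OF that]] e
    by (simp add: m_def power2_eq_square mult_ac)
  have V_le_E: "m \<beta> 2 \<le> E \<beta>" if "0 \<le> \<beta>" for \<beta>
    using bounded_intensity.moment_antimono[OF I[OF that], of 1 2] by (simp add: E_eq[OF that] m_def)
  have E_le: "E \<beta> \<le> A * m \<beta> 2" if "0 \<le> \<beta>" for \<beta>
  proof -
    have "tilted g \<beta> x \<le> G * exp (\<beta> / 2)" if x: "x \<in> {0..1 / 2}" for x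
    proof -
      have "\<beta> * x \<le> \<beta> * (1 / 2)" using x \<open>0 \<le> \<beta>\<close> by (intro mult_left_mono) auto
      then have "exp (\<beta> * x) * g x \<le> exp (\<beta> / 2) * G"
        using x G[of x] g_nonneg[of x] by (intro mult_mono) auto
      then show ?thesis using x by (simp add: tilted_def mult.commute)
    qed
    then have "m \<beta> 1 \<le> 2 * m \<beta> 2 + G * exp (\<beta> / 2)"
      unfolding m_def by (rule bounded_intensity.moment_1_le[OF I[OF that]])
    moreover have "G * exp (\<beta> / 2) \<le> 4 * G / e\<^sup>2 * m \<beta> 2"
      using mult_left_mono[OF V_lower[OF that], of "4 * G / e\<^sup>2"] e G1 by simp
    ultimately show ?thesis by (simp add: E_eq[OF that] A_def distrib_right)
  qed
  have growth: "filterlim (\<lambda>\<beta>::real. e\<^sup>2 / 4 * exp (\<beta> / 2)) at_top at_top"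
    using e by (intro filterlim_exp_half_at_top) simp
  have "filterlim E at_top at_top"
  proof (rule filterlim_at_top_mono[OF growth])
    show "\<forall>\<^sub>F \<beta> in at_top. e\<^sup>2 / 4 * exp (\<beta> / 2) \<le> E \<beta>"
      using eventually_ge_at_top[of 0] by eventually_elim (use V_lower V_le_E order_trans in blast)
  qed
  have ev: "\<forall>\<^sub>F \<beta> in at_top. 0 \<le> \<beta> \<and> 1 \<le> e\<^sup>2 / 4 * exp (\<beta> / 2) \<and> 4 * (G * exp \<beta>) ^ 4 * exp (- (d * exp (\<beta> / 2))) \<le> 1"
  proof -
    have "4 * G ^ 4 * exp (\<beta> / 2) ^ 8 = 4 * (G * exp \<beta>) ^ 4" for \<beta>
      by (simp add: power_mult_distrib flip: exp_of_nat_mult)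
    then have "\<forall>\<^sub>F \<beta> in at_top. 4 * (G * exp \<beta>) ^ 4 * exp (- (d * exp (\<beta> / 2))) < 1"
      using order_tendstoD(2)[OF polynomial_times_double_exp_decay[OF d0, of "4 * G ^ 4" 8], of 1] by (simp only: zero_less_one)
    moreover have "\<forall>\<^sub>F \<beta> in at_top. 1 \<le> e\<^sup>2 / 4 * exp (\<beta> / 2)"
      using growth unfolding filterlim_at_top by blast
    ultimately show ?thesis
      using eventually_ge_at_top[of "0::real"] by eventually_elim auto
  qed
  have bounds: "(\<forall>y. \<bar>standardized_defective_density g \<beta> (M \<beta>) (T \<beta>) y - 1 / sqrt (2 * pi) * exp (- y\<^sup>2 / 2)\<bar>
        \<le> (?K * sqrt A + 1) * (1 / sqrt (E \<beta>))) \<and>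
      \<bar>standardized_defective_density g \<beta> (M \<beta>) (T \<beta>) 0 - 1 / sqrt (2 * pi)\<bar> \<le> (?K * A + 1) * (1 / E \<beta>)"
    if \<beta>: "0 \<le> \<beta>" "1 \<le> e\<^sup>2 / 4 * exp (\<beta> / 2)" "4 * (G * exp \<beta>) ^ 4 * exp (- (d * exp (\<beta> / 2))) \<le> 1" for \<beta>
  proof -
    interpret I: bounded_intensity "tilted g \<beta>" "G * exp \<beta>" by (rule I[OF \<beta>(1)])
    define \<kappa> where "\<kappa> = e * exp (\<beta> / 2) * (e * \<eta>)"
    have mI: "m \<beta> = I.moment" by (simp add: m_def)
    have V1: "1 \<le> I.moment 2" using V_lower[OF \<beta>(1)] \<beta>(2) by (simp add: mI)
    have E: "E \<beta> = I.moment 1" using E_eq[OF \<beta>(1)] by (simp add: mI)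
    have E1: "1 \<le> E \<beta>" using V_le_E[OF \<beta>(1)] V1 by (simp add: mI)
    have gap: "\<bar>Re (fourier (tilted g \<beta>) t)\<bar> \<le> I.moment 0 - \<kappa>" if "1 < \<bar>t\<bar>" for t
      unfolding \<kappa>_def \<eta>_def using e that by (intro I.spectral_gap low[OF \<beta>(1)]) auto
    have "d * exp (\<beta> / 2) \<le> e\<^sup>2 * \<eta> * exp (\<beta> / 2)"
      by (intro mult_right_mono) (auto simp: d_def)
    then have d\<kappa>: "d * exp (\<beta> / 2) \<le> \<kappa>"
      by (simp add: \<kappa>_def power2_eq_square mult_ac)
    have "d * exp (\<beta> / 2) \<le> e\<^sup>2 / 4 * exp (\<beta> / 2)"
      by (intro mult_right_mono) (auto simp: d_def)
    then have dm: "d * exp (\<beta> / 2) \<le> I.moment 0"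
      using V_lower[OF \<beta>(1)] I.moment_antimono[of 0 2] unfolding mI by linarith
    note err = I.local_limit_error_le[OF V1 gap d\<kappa> dm \<beta>(3), folded E]
    have normal: "std_normal_density y = 1 / sqrt (2 * pi) * exp (- y\<^sup>2 / 2)" for y
      by (simp add: normal_density_def)
    have dens: "standardized_defective_density g \<beta> (M \<beta>) (T \<beta>) y
        = sqrt (I.moment 2) * I.compound_density (sqrt (I.moment 2) * y + I.moment 1)" for y
      by (rule standardized_density_eq_compound_density(2)[OF I[OF \<beta>(1)] prob T_measurable T_mgf])
    have AE: "E \<beta> \<le> A * I.moment 2" using E_le[OF \<beta>(1)] by (simp add: mI)
    have K0: "0 \<le> ?K" by (rule local_limit_const_nonneg)
    have invV: "1 / I.moment 2 \<le> A * (1 / E \<beta>)"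
      using AE E1 V1 by (simp add: field_simps)
    have "sqrt (1 / I.moment 2) \<le> sqrt (A * (1 / E \<beta>))"
      by (rule real_sqrt_le_mono[OF invV])
    then have inv_sqrtV: "1 / sqrt (I.moment 2) \<le> sqrt A * (1 / sqrt (E \<beta>))"
      by (simp add: real_sqrt_divide real_sqrt_mult)
    have "sqrt (E \<beta>) \<le> E \<beta>"
      using E1 real_sqrt_le_mono[of "E \<beta>" "(E \<beta>)\<^sup>2"] power_increasing[of 1 2 "E \<beta>"] by simp
    then have invE: "1 / E \<beta> \<le> 1 / sqrt (E \<beta>)"
      using E1 by (intro divide_left_mono) auto
    show ?thesis
    proof (intro conjI allI)
      fix y
      have "\<bar>standardized_defective_density g \<beta> (M \<beta>) (T \<beta>) y - 1 / sqrt (2 * pi) * exp (- y\<^sup>2 / 2)\<bar>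
          \<le> ?K * (1 / sqrt (I.moment 2)) + 1 / E \<beta>"
        unfolding dens normal[symmetric]
        using I.local_limit_bounds(1)[OF V1 gap, of y] err by simp
      also have "\<dots> \<le> ?K * (sqrt A * (1 / sqrt (E \<beta>))) + 1 / sqrt (E \<beta>)"
        by (intro add_mono mult_left_mono inv_sqrtV invE K0)
      also have "\<dots> = (?K * sqrt A + 1) * (1 / sqrt (E \<beta>))"
        by (simp add: algebra_simps)
      finally show "\<bar>standardized_defective_density g \<beta> (M \<beta>) (T \<beta>) y - 1 / sqrt (2 * pi) * exp (- y\<^sup>2 / 2)\<bar>
          \<le> (?K * sqrt A + 1) * (1 / sqrt (E \<beta>))" .
    next
      have "\<bar>standardized_defective_density g \<beta> (M \<beta>) (T \<beta>) 0 - 1 / sqrt (2 * pi)\<bar> \<le> ?K * (1 / I.moment 2) + 1 / E \<beta>"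
        using I.local_limit_bounds(2)[OF V1 gap] err normal[of 0] dens[of 0] by simp
      also have "\<dots> \<le> ?K * (A * (1 / E \<beta>)) + 1 / E \<beta>"
        by (intro add_right_mono mult_left_mono invV K0)
      also have "\<dots> = (?K * A + 1) * (1 / E \<beta>)"
        by (simp add: algebra_simps)
      finally show "\<bar>standardized_defective_density g \<beta> (M \<beta>) (T \<beta>) 0 - 1 / sqrt (2 * pi)\<bar> \<le> (?K * A + 1) * (1 / E \<beta>)" .
    qed
  qed
  have "\<forall>\<^sub>F \<beta> in at_top. \<forall>y. \<bar>standardized_defective_density g \<beta> (M \<beta>) (T \<beta>) y - 1 / sqrt (2 * pi) * exp (- y\<^sup>2 / 2)\<bar>
        \<le> (?K * sqrt A + 1) * (1 / sqrt (E \<beta>))"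
    using ev by eventually_elim (use bounds in blast)
  moreover have "(\<lambda>\<beta>. standardized_defective_density g \<beta> (M \<beta>) (T \<beta>) 0 - 1 / sqrt (2 * pi)) \<in> O[at_top](\<lambda>\<beta>. 1 / E \<beta>)"
  proof (rule bigoI[where c="?K * A + 1"])
    show "\<forall>\<^sub>F \<beta> in at_top. norm (standardized_defective_density g \<beta> (M \<beta>) (T \<beta>) 0 - 1 / sqrt (2 * pi)) \<le> (?K * A + 1) * norm (1 / E \<beta>)"
      using ev
    proof eventually_elim
      case (elim \<beta>)
      then have "0 \<le> E \<beta>" using V_lower[of \<beta>] V_le_E[of \<beta>] by linarith
      then show ?case using bounds[of \<beta>] elim by simp
    qed
  qed
  ultimately show ?thesis
    using \<open>filterlim E at_top at_top\<close> unfolding E_def by blast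
qed

end
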